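(* Consider the numerical method which, given $\omega^k=(\omega_1^k,\omega_2^k,0)$, determines $\omega^{k+1}=(\omega_1^{k+1},\omega_2^{k+1},0)$ and $\lambda_{k+1}$ from $$\mathbb I_m\begin{pmatrix}\omega_1^{k+1}-\omega_1^k\\ \omega_2^{k+1}-\omega_2^k\end{pmatrix}+\frac\epsilon2\begin{pmatrix}\omega_2^{k+1}(\mathbb I_{3i}\omega_i^{k+1})+\omega_2^k(\mathbb I_{3i}\omega_i^k)\\ -\omega_1^{k+1}(\mathbb I_{3i}\omega_i^{k+1})-\omega_1^k(\mathbb I_{3i}\omega_i^k)\end{pmatrix}+\frac{\epsilon^2}{4}M(\omega^{k+1})\,\mathbb I_m\begin{pmatrix}\omega_1^{k+1}\\ \omega_2^{k+1}\end{pmatrix}-\frac{\epsilon^2}4M(\omega^k)\,\mathbb I_m\begin{pmatrix}\omega_1^k\\ \omega_2^k\end{pmatrix}=0,$$ $$\lambda_{k+1}=\tfrac12\bigl(\omega_1^{k+1}(\mathbb I_{2i}\omega_i^{k+1})+\omega_1^k(\mathbb I_{2i}\omega_i^k)\bigr)-\tfrac12\bigl(\omega_2^{k+1}(\mathbb I_{1i}\omega_i^{k+1})+\omega_2^k(\mathbb I_{1i}\omega_i^k)\bigr),$$ where $M(\omega)=\begin{pmatrix}\omega_1^2&\omega_1\omega_2\\ \omega_1\omega_2&\omega_2^2\end{pmatrix}$ and repeated $i$ is summed over $i=1,2$. Then this method is consistent of order $(2,\star)$ with respect to the Suslov problem and consequently, with the reconstruction $R_{k+1}=R_k\,\mathrm{cay}(\epsilon\hat\omega^k)$,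 $v_{R_k}=R_k\hat\omega^k$, of order $(1,\star)$ with respect to the unreduced nonholonomic equations on $SO(3)$. Here $\star$ means that the method is not necessarily consistent concerning the multipliers (i.e. the multiplier error $|\lambda(t_k+\epsilon)-\lambda_{k+1}|$ need not be $O(\epsilon)$ in general).
   Context: Notation: $\hat\cdot:\mathbb R^3\to\mathfrak{so}(3)$ is the standard isomorphism with $\hat\omega x=\omega\times x$; the distance on $\mathfrak{so}(3)$ is the Euclidean distance of $\mathbb R^3$; on $SO(3)$, $\mathrm{dist}(R_1,R_2)=|I-R_1R_2^T|$ with $|A|^2=\sum_{ij}|A_{ij}|^2$; $\mathrm{cay}(\hat\omega)=(I-\frac{\hat\omega}2)^{-1}(I+\frac{\hat\omega}2)$. $\mathbb I=(\mathbb I_{ij})$ is a symmetric positive definite $3\times3$ inertia tensor and $\mathbb I_m$ its upper-left $2\times2$ block. An upper index $k$ denotes the time step; $\epsilon>0$ is the step size, and $\omega^{k+1}$ is the solution of the implicit equation close to $\omega^k$ for small $\epsilon$. Suslov problem: $\mathbb I\dot\omega=\mathbb I\omega\times\omega+\lambda e_3$, $\omega_3=0$, $e_3=(0,0,1)$, with solutions $(\omega(t),\lambda(t))$. The unreduced system on $SO(3)$ is the Lagrange-d'Alembert system with Lagrangian $L(R,\dot R)=\frac12\langle\mathbb I\omega,\omega\rangle$, $\hat\omega=R^{-1}\dot R$, and constraint distribution $D_R=\{R\hat\omega:\omega_3=0\}$, with multiplier taken with respect to the annihilating one-form $\mu(R)=\ell^*_{R^{-1}}e_3$ ($\ell$ =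 left translation); its solutions satisfy $\dot R=R\hat\omega$ with $\omega$ a solution of the Suslov problem, and the multiplier is the same. Order $(p,s)$ for the Suslov problem means $|\omega(t_k+\epsilon)-\omega^{k+1}|=O(\epsilon^{p+1})$ and $|\lambda(t_k+\epsilon)-\lambda_{k+1}|=O(\epsilon^{s+1})$, $s\ge0$. Order $(p,s)$ for the unreduced equations means $\mathrm{dist}(R(t_k+\epsilon),R_{k+1})=O(\epsilon^{r+1})$, $|R(t_k+\epsilon)^{-1}v_{R(t_k+\epsilon)}-R_{k+1}^{-1}v_{R_{k+1}}|=O(\epsilon^{q+1})$ with $\min(r,q)=p$, and $|\lambda(t_k+\epsilon)-\lambda_{k+1}|=O(\epsilon^{s+1})$. With $\star$ in place of $s$, the condition on the multipliers is dropped. All errors are local (one-step) errors as $\epsilon\to0$, with exact solution satisfying $\omega(t_k)=\omega^k$ and $R(t_k)=R_k$. *)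

theory Defs
  imports "HOL-Analysis.Analysis" "HOL-Library.Landau_Symbols"
begin

section \<open>The Lie algebra so(3) and the Cayley map\<close>

definition e3 :: "real^3" where
  "e3 = axis 3 1"

definition hat :: "real^3 \<Rightarrow> real^3^3" where
  "hat w = matrix (cross3 w)"

text \<open>The inverse of \<^const>\<open>hat\<close> on skew-symmetric matrices; elsewhere its value is irrelevant.\<close>

definition vee :: "real^3^3 \<Rightarrow> real^3" where
  "vee A = vector [A$3$2, A$1$3, A$2$1]"

lemma hat_works: "hat w *v x = cross3 w x"
  by (simp add: hat_def matrix_def matrix_vector_mult_def sum_3 cross3_def vec_eq_iff forall_3
      axis_def)

lemma vee_hat [simp]: "vee (hat w) = w"
  by (simp add: vee_def hat_def matrix_def cross3_def vec_eq_iff forall_3 axis_def)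

lemma hat_vee:
  assumes "transpose A = - A"
  shows "hat (vee A) = A"
proof -
  have "A $ j $ i = - A $ i $ j" for i j
    using arg_cong[OF assms, of "\<lambda>B. B $ i $ j"] by (simp add: transpose_def)
  from this[of 1 1] this[of 2 2] this[of 3 3] this[of 1 2] this[of 1 3] this[of 2 3]
  show ?thesis
    by (simp add: vee_def hat_def matrix_def cross3_def vec_eq_iff forall_3 axis_def)
qed

definition cay :: "real^3^3 \<Rightarrow> real^3^3" where
  "cay A = matrix_inv (mat 1 - (1/2) *\<^sub>R A) ** (mat 1 + (1/2) *\<^sub>R A)"

text \<open>The norm of \<^typ>\<open>real^3^3\<close> is the Euclidean norm of the vector of the Euclidean norms of
  the rows, that is, the Frobenius norm.\<close>

definition SO3_dist :: "real^3^3 \<Rightarrow> real^3^3 \<Rightarrow> real" where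
  "SO3_dist R1 R2 = norm (mat 1 - R1 ** transpose R2)"

section \<open>The Suslov problem\<close>

definition inertia_tensor :: "real^3^3 \<Rightarrow> bool" where
  "inertia_tensor I \<longleftrightarrow> transpose I = I \<and> (\<forall>x. x \<noteq> 0 \<longrightarrow> 0 < (I *v x) \<bullet> x)"

definition suslov_solution ::
  "real^3^3 \<Rightarrow> real set \<Rightarrow> (real \<Rightarrow> real^3) \<Rightarrow> (real \<Rightarrow> real) \<Rightarrow> bool" where
  "suslov_solution I J \<omega> lam \<longleftrightarrow>
     (\<exists>\<omega>'. \<forall>t\<in>J. (\<omega> has_vector_derivative \<omega>' t) (at t within J) \<and>
                I *v \<omega>' t = cross3 (I *v \<omega> t) (\<omega> t) + lam t *\<^sub>R e3 \<and>
                \<omega> t $ 3 = 0)"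

section \<open>The unreduced system on SO(3)\<close>

definition lagrangian :: "real^3^3 \<Rightarrow> real^3^3 \<Rightarrow> real^3^3 \<Rightarrow> real" where
  "lagrangian I R V = (let w = vee (matrix_inv R ** V) in (1/2) * ((I *v w) \<bullet> w))"

definition constraint_distribution :: "real^3^3 \<Rightarrow> (real^3^3) set" where
  "constraint_distribution R = {R ** hat w | w. w $ 3 = 0}"

text \<open>The left-invariant one-form with value \<^const>\<open>e3\<close> at the identity, evaluated on a
  tangent vector \<open>V\<close> at \<open>R\<close>.\<close>

definition constraint_form :: "real^3^3 \<Rightarrow> real^3^3 \<Rightarrow> real" where
  "constraint_form R V = e3 \<bullet> vee (matrix_inv R ** V)"

text \<open>Fixed-endpoint variations \<open>X s t\<close> of a curve \<open>R\<close> in SO(3), with partial derivatives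
  \<open>Xs\<close>, \<open>Xt\<close> and mixed second derivative \<open>Xst\<close>. The pure second derivatives play no role in
  the first variation of the action, so they are not required to exist. The parameter interval
  for \<open>s\<close> can be chosen as \<open>(-1,1)\<close> by rescaling.\<close>

definition SO3_variation ::
  "real \<Rightarrow> real \<Rightarrow> (real \<Rightarrow> real^3^3) \<Rightarrow> (real \<Rightarrow> real \<Rightarrow> real^3^3) \<Rightarrow>
   (real \<Rightarrow> real \<Rightarrow> real^3^3) \<Rightarrow> (real \<Rightarrow> real \<Rightarrow> real^3^3) \<Rightarrow> bool" where
  "SO3_variation a b R X Xs Xt \<longleftrightarrow>
     (\<forall>t\<in>{a..b}. X 0 t = R t) \<and>
     (\<forall>s\<in>{-1<..<1}. X s a = R a \<and> X s b = R b) \<and>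
     (\<forall>s\<in>{-1<..<1}. \<forall>t\<in>{a..b}. rotation_matrix (X s t)) \<and>
     (\<exists>Xst.
       (\<forall>s\<in>{-1<..<1}. \<forall>t\<in>{a..b}.
          ((\<lambda>s. X s t) has_vector_derivative Xs s t) (at s) \<and>
          (X s has_vector_derivative Xt s t) (at t within {a..b}) \<and>
          ((\<lambda>s. Xt s t) has_vector_derivative Xst s t) (at s) \<and>
          (Xs s has_vector_derivative Xst s t) (at t within {a..b})) \<and>
       continuous_on (Sigma {-1<..<1} (\<lambda>_. {a..b})) (\<lambda>(s, t). Xs s t) \<and>
       continuous_on (Sigma {-1<..<1} (\<lambda>_. {a..b})) (\<lambda>(s, t). Xt s t) \<and>
       continuous_on (Sigma {-1<..<1} (\<lambda>_. {a..b})) (\<lambda>(s, t). Xst s t))"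

text \<open>The Lagrange-d'Alembert principle with multiplier: the curve satisfies the constraint, and
  for every variation the first variation of the action is minus the integral of \<open>lam\<close> times the
  constraint form on the variation field. This is the weak form of
  \<open>d/dt (\<partial>L/\<partial>R') - \<partial>L/\<partial>R = lam \<mu>(R)\<close>, which fixes the sign of the multiplier. The
  function \<open>V\<close> is the velocity of the curve \<open>R\<close>.\<close>

definition lagrange_dalembert_solution ::
  "real^3^3 \<Rightarrow> real \<Rightarrow> real \<Rightarrow> (real \<Rightarrow> real^3^3) \<Rightarrow> (real \<Rightarrow> real^3^3) \<Rightarrow> (real \<Rightarrow> real) \<Rightarrow> bool" where
  "lagrange_dalembert_solution I a b R V lam \<longleftrightarrow>
     (\<forall>t\<in>{a..b}. rotation_matrix (R t) \<and> V t \<in> constraint_distribution (R t)) \<and>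
     (\<exists>A. continuous_on {a..b} A \<and>
        (\<forall>t\<in>{a..b}. (R has_vector_derivative V t) (at t within {a..b}) \<and>
                    (V has_vector_derivative A t) (at t within {a..b}))) \<and>
     continuous_on {a..b} lam \<and>
     (\<forall>X Xs Xt. SO3_variation a b R X Xs Xt \<longrightarrow>
        ((\<lambda>s. integral {a..b} (\<lambda>t. lagrangian I (X s t) (Xt s t))) has_real_derivative
          - integral {a..b} (\<lambda>t. lam t * constraint_form (R t) (Xs 0 t))) (at 0))"

section \<open>One-step methods and their order\<close>

text \<open>A method is a relation \<open>\<Phi> h x x' l\<close> between the step size, the old state, the new state and
  the new multiplier. A branch is the step as a function of the step size, selected among the
  solutions of the implicit equations by closeness to the old state for small step size.\<close>

type_synonym 's one_step_method = "real \<Rightarrow> 's \<Rightarrow> 's \<Rightarrow> real \<Rightarrow> bool"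

definition step_branch ::
  "'s::topological_space one_step_method \<Rightarrow> 's \<Rightarrow> (real \<Rightarrow> 's) \<Rightarrow> (real \<Rightarrow> real) \<Rightarrow> bool" where
  "step_branch \<Phi> x X \<Lambda> \<longleftrightarrow>
     (\<forall>\<^sub>F h in at_right 0. \<Phi> h x (X h) (\<Lambda> h)) \<and> (X \<longlongrightarrow> x) (at_right 0)"

definition well_defined_step :: "'s::topological_space one_step_method \<Rightarrow> 's \<Rightarrow> bool" where
  "well_defined_step \<Phi> x \<longleftrightarrow>
     (\<exists>X \<Lambda>. step_branch \<Phi> x X \<Lambda>) \<and>
     (\<forall>X \<Lambda> X' \<Lambda>'. step_branch \<Phi> x X \<Lambda> \<longrightarrow> step_branch \<Phi> x X' \<Lambda>' \<longrightarrow>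
        (\<forall>\<^sub>F h in at_right 0. X h = X' h \<and> \<Lambda> h = \<Lambda>' h))"

definition suslov_velocity_order :: "real^3^3 \<Rightarrow> (real^3) one_step_method \<Rightarrow> nat \<Rightarrow> bool" where
  "suslov_velocity_order I \<Phi> p \<longleftrightarrow>
     (\<forall>t0 T \<omega> lam W \<Lambda>. 0 < T \<longrightarrow> suslov_solution I {t0..t0 + T} \<omega> lam \<longrightarrow>
        step_branch \<Phi> (\<omega> t0) W \<Lambda> \<longrightarrow>
        (\<lambda>h. norm (\<omega> (t0 + h) - W h)) \<in> O[at_right 0](\<lambda>h. h ^ (p + 1)))"

definition suslov_multiplier_order :: "real^3^3 \<Rightarrow> (real^3) one_step_method \<Rightarrow> nat \<Rightarrow> bool" where
  "suslov_multiplier_order I \<Phi> s \<longleftrightarrow>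
     (\<forall>t0 T \<omega> lam W \<Lambda>. 0 < T \<longrightarrow> suslov_solution I {t0..t0 + T} \<omega> lam \<longrightarrow>
        step_branch \<Phi> (\<omega> t0) W \<Lambda> \<longrightarrow>
        (\<lambda>h. \<bar>lam (t0 + h) - \<Lambda> h\<bar>) \<in> O[at_right 0](\<lambda>h. h ^ (s + 1)))"

text \<open>Order \<open>(p, s)\<close> is encoded with \<open>Some s\<close>; \<^const>\<open>None\<close> stands for the star, which drops
  the condition on the multipliers.\<close>

definition suslov_order ::
  "real^3^3 \<Rightarrow> (real^3) one_step_method \<Rightarrow> nat \<Rightarrow> nat option \<Rightarrow> bool" where
  "suslov_order I \<Phi> p s \<longleftrightarrow>
     suslov_velocity_order I \<Phi> p \<and>
     (case s of None \<Rightarrow> True | Some s' \<Rightarrow> suslov_multiplier_order I \<Phi> s')"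

text \<open>States of methods for the unreduced system are pairs of a rotation and a tangent vector
  there.\<close>

definition unreduced_order ::
  "real^3^3 \<Rightarrow> ((real^3^3) \<times> (real^3^3)) one_step_method \<Rightarrow> nat \<Rightarrow> nat option \<Rightarrow> bool" where
  "unreduced_order I \<Phi> p s \<longleftrightarrow>
     (\<exists>r q. min r q = p \<and>
       (\<forall>t0 T R V lam X \<Lambda>. 0 < T \<longrightarrow> lagrange_dalembert_solution I t0 (t0 + T) R V lam \<longrightarrow>
          step_branch \<Phi> (R t0, V t0) X \<Lambda> \<longrightarrow>
          (\<lambda>h. SO3_dist (R (t0 + h)) (fst (X h))) \<in> O[at_right 0](\<lambda>h. h ^ (r + 1)) \<and>
          (\<lambda>h. norm (vee (matrix_inv (R (t0 + h)) ** V (t0 + h))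
                     - vee (matrix_inv (fst (X h)) ** snd (X h))))
            \<in> O[at_right 0](\<lambda>h. h ^ (q + 1)) \<and>
          (case s of None \<Rightarrow> True | Some s' \<Rightarrow>
            (\<lambda>h. \<bar>lam (t0 + h) - \<Lambda> h\<bar>) \<in> O[at_right 0](\<lambda>h. h ^ (s' + 1)))))"

section \<open>The numerical method\<close>

definition inertia_block :: "real^3^3 \<Rightarrow> real^2^2" where
  "inertia_block I = vector [vector [I$1$1, I$1$2], vector [I$2$1, I$2$2]]"

definition planar :: "real^3 \<Rightarrow> real^2" where
  "planar w = vector [w$1, w$2]"

definition planar_row :: "real^3^3 \<Rightarrow> 3 \<Rightarrow> real^3 \<Rightarrow> real" where
  "planar_row I j w = (\<Sum>i\<in>{1, 2}. I$j$i * w$i)"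

definition M_matrix :: "real^3 \<Rightarrow> real^2^2" where
  "M_matrix w = vector [vector [(w$1)^2, w$1 * w$2], vector [w$1 * w$2, (w$2)^2]]"

definition suslov_scheme :: "real^3^3 \<Rightarrow> (real^3) one_step_method" where
  "suslov_scheme I h w w' l \<longleftrightarrow>
     w $ 3 = 0 \<and> w' $ 3 = 0 \<and>
     inertia_block I *v (planar w' - planar w)
       + (h / 2) *\<^sub>R vector [w'$2 * planar_row I 3 w' + w$2 * planar_row I 3 w,
                           - (w'$1 * planar_row I 3 w') - w$1 * planar_row I 3 w]
       + (h^2 / 4) *\<^sub>R (M_matrix w' *v (inertia_block I *v planar w'))
       - (h^2 / 4) *\<^sub>R (M_matrix w *v (inertia_block I *v planar w)) = 0 \<and>
     l = (1/2) * (w'$1 * planar_row I 2 w' + w$1 * planar_row I 2 w)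
         - (1/2) * (w'$2 * planar_row I 1 w' + w$2 * planar_row I 1 w)"

text \<open>The Cayley increment uses the old angular velocity; the new one enters only through the new
  tangent vector.\<close>

definition reconstruction ::
  "(real^3) one_step_method \<Rightarrow> ((real^3^3) \<times> (real^3^3)) one_step_method" where
  "reconstruction \<Phi> h x x' l \<longleftrightarrow>
     (\<exists>R w w'. rotation_matrix R \<and> \<Phi> h w w' l \<and>
        x = (R, R ** hat w) \<and>
        (let R' = R ** cay (h *\<^sub>R hat w) in x' = (R', R' ** hat w')))"

end

theory Submission
  imports Defs
begin

text \<open>
  Eliminating the multiplier, the Suslov problem becomes \<open>u' = Q(u, u)\<close> in the plane with \<open>Q\<close>
  bilinear, and the method becomes the trapezoidal rule for this equation perturbed by
  \<open>h\<^sup>2 (k(u\<^sub>1) - k(u\<^sub>0)) = O(h\<^sup>3)\<close>. The implicit equation is a contraction near \<open>u\<^sub>0\<close>, and the trapezoidal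
  rule has local error \<open>O(h\<^sup>3)\<close>.

  For the unreduced system, variations of the form \<open>R(t) exp(s \<phi>(t) n)\<close> with a fixed
  axis \<open>n\<close> turn the Lagrange-d'Alembert principle into the weak form of the Suslov equations, and the
  du Bois-Reymond lemma gives the strong form. The Cayley update \<open>R\<^sub>k cay(h \<omega>\<^sub>k)\<close> agrees with
  the curve to first order, which limits the order to 1.

  The multiplier of the method lacks the term \<open>I\<^sub>3\<^sub>1 \<omega>\<^sub>1' + I\<^sub>3\<^sub>2 \<omega>\<^sub>2'\<close>, so its error does not tend to 0
  along a solution on which this term is nonzero.
\<close>

section \<open>The perturbed trapezoidal rule\<close>

text \<open>On the plane \<open>\<omega> $ 3 = 0\<close> the first two components of
  \<open>cross3 (I *v \<omega>) \<omega>\<close> are minus the third momentum component times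
  (omega_2, -omega_1), and \<open>e3\<close> enters only the third equation; this is where Q comes
  from. The matrix M is u u^T, so the perturbation k is a multiple of I_m^{-1} (u . I_m u) u.
  Solutions of the Suslov problem are given as once differentiable, so a third-order Taylor theorem
  does not apply directly. Because the field is quadratic, its increments are exact bilinear
  expressions in the displacement, and powers of the step size are gained by alternately
  substituting a bound and integrating it. The constant in a local error may depend on the solution,
  so Lipschitz estimates are confined to the unit ball about the initial state. The Cayley map is
  never expanded in a series: the identity Y = 1 + S (Y + 1) with S skew gives both orthogonality
  and a second-order bound for every step size.\<close>

lemma (in bounded_bilinear) lipschitz_on_prod:
  assumes "compact S" "A-lipschitz_on S f" "B-lipschitz_on S g"
  shows "\<exists>L. L-lipschitz_on S (\<lambda>x. prod (f x) (g x))"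
proof -
  obtain K where K: "K \<ge> 0" "\<And>a b. norm (prod a b) \<le> norm a * norm b * K"
    using nonneg_bounded by blast
  have "compact (f ` S)" "compact (g ` S)"
    using assms by (auto intro!: compact_continuous_image lipschitz_on_continuous_on)
  then have bdd: "bounded (f ` S)" "bounded (g ` S)"
    by (auto dest: compact_imp_bounded)
  obtain F where F: "F > 0" "\<And>x. x \<in> S \<Longrightarrow> norm (f x) \<le> F"
    using bdd(1) by (force simp: bounded_pos)
  obtain G where G: "G > 0" "\<And>x. x \<in> S \<Longrightarrow> norm (g x) \<le> G"
    using bdd(2) by (force simp: bounded_pos)
  have AB: "A \<ge> 0" "B \<ge> 0"
    using assms(2,3) lipschitz_on_nonneg by auto
  show ?thesis
  proof (intro exI lipschitz_onI)
    fix x y assume xy: "x \<in> S" "y \<in> S"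
    \<comment> \<open>One factor changes at a time; compactness bounds the factor that
      stays.\<close>
    have "prod (f x) (g x) - prod (f y) (g y) = prod (f x - f y) (g x) + prod (f y) (g x - g y)"
      by (simp add: diff_left diff_right)
    also have "norm \<dots> \<le> norm (f x - f y) * norm (g x) * K + norm (f y) * norm (g x - g y) * K"
      by (intro norm_triangle_le add_mono K)
    also have "\<dots> \<le> (A * dist x y) * G * K + F * (B * dist x y) * K"
      using assms(2,3) xy F G K AB
      by (intro add_mono mult_mono) (auto simp: lipschitz_on_def dist_norm less_imp_le)
    finally show "dist (prod (f x) (g x)) (prod (f y) (g y)) \<le> ((A * G + F * B) * K) * dist x y"
      by (simp add: dist_norm algebra_simps)
  qed (use AB F G K in auto)
qed

definition implicit_step :: "('a::real_vector \<Rightarrow> 'a) \<Rightarrow> ('a \<Rightarrow> 'a) \<Rightarrow> real \<Rightarrow> 'a \<Rightarrow> 'a \<Rightarrow> bool" where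
  "implicit_step f k h x y \<longleftrightarrow>
     y = x + (h / 2) *\<^sub>R (f x + f y) + h\<^sup>2 *\<^sub>R (k y - k x)"

text \<open>The exact factor is L (h/2 + h^2); for h at most 1 both summands are enlarged to L h,
  which gives the constant 2.\<close>

lemma implicit_step_contraction:
  fixes f k :: "'a::real_normed_vector \<Rightarrow> 'a"
  assumes f: "L-lipschitz_on (cball x 1) f" and k: "L-lipschitz_on (cball x 1) k"
    and h: "0 < h" "h \<le> 1" and y: "y \<in> cball x 1" and z: "z \<in> cball x 1"
  defines "G \<equiv> \<lambda>y. x + (h / 2) *\<^sub>R (f x + f y) + h\<^sup>2 *\<^sub>R (k y - k x)"
  shows "dist (G y) (G z) \<le> 2 * L * h * dist y z"
proof -
  have L: "L \<ge> 0" using f lipschitz_on_nonneg by auto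
  have h2: "h\<^sup>2 \<le> h" using h by (simp add: power2_eq_square mult_left_le)
  have "G y - G z = (h / 2) *\<^sub>R (f y - f z) + h\<^sup>2 *\<^sub>R (k y - k z)"
    by (simp add: G_def algebra_simps)
  also have "norm \<dots> \<le> (h / 2) * (L * dist y z) + h\<^sup>2 * (L * dist y z)"
    using f k y z h by (intro norm_triangle_le add_mono) (auto simp: lipschitz_on_def dist_norm)
  also have "\<dots> \<le> h * (L * dist y z) + h * (L * dist y z)"
    using h L h2 by (intro add_mono mult_right_mono) auto
  finally show ?thesis
    by (simp add: dist_norm algebra_simps)
qed

text \<open>At \<open>y = x\<close> the correction cancels and the map moves \<open>x\<close> by
  exactly h f(x); the contraction estimate accounts for the rest. The bound serves twice: as the
  self-map property for the fixed point theorem, and as an a priori O(h) bound on any solution in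
  the ball.\<close>

lemma implicit_step_displacement:
  fixes f k :: "'a::real_normed_vector \<Rightarrow> 'a"
  assumes f: "L-lipschitz_on (cball x 1) f" and k: "L-lipschitz_on (cball x 1) k"
    and h: "0 < h" "h \<le> 1" and y: "y \<in> cball x 1"
  shows "dist (x + (h / 2) *\<^sub>R (f x + f y) + h\<^sup>2 *\<^sub>R (k y - k x)) x \<le> (norm (f x) + 2 * L) * h"
proof -
  define G where "G y = x + (h / 2) *\<^sub>R (f x + f y) + h\<^sup>2 *\<^sub>R (k y - k x)" for y
  have L: "L \<ge> 0" using f lipschitz_on_nonneg by auto
  have "dist (G y) (G x) \<le> 2 * L * h * dist y x"
    unfolding G_def by (rule implicit_step_contraction[OF f k h y]) simp
  also have "\<dots> \<le> 2 * L * h * 1"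
    using h L y by (intro mult_left_mono) (auto simp: dist_commute)
  finally have "dist (G y) (G x) \<le> 2 * L * h" by simp
  moreover have "G x - x = h *\<^sub>R f x" by (simp add: G_def flip: scaleR_2)
  then have "dist (G x) x = h * norm (f x)" using h by (simp add: dist_norm)
  ultimately have "dist (G y) x \<le> (norm (f x) + 2 * L) * h"
    using dist_triangle[of "G y" x "G x"] by (simp add: algebra_simps)
  then show ?thesis by (simp add: G_def)
qed

lemma eventually_at_right_0_mult_le:
  fixes c e :: real
  assumes "e > 0"
  shows "\<forall>\<^sub>F h in at_right 0. c * h \<le> e"
proof -
  have "((\<lambda>h. c * h) \<longlongrightarrow> c * 0) (at_right 0)" by (intro tendsto_intros)
  then have "\<forall>\<^sub>F h in at_right 0. c * h < e"
    using assms by (intro order_tendstoD) auto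
  then show ?thesis by eventually_elim simp
qed

text \<open>The threshold on h does not depend on the two solutions, so it applies to two branches
  that vary with h, once both have entered the unit ball.\<close>

lemma implicit_step_unique:
  fixes f k :: "'a::real_normed_vector \<Rightarrow> 'a"
  assumes f: "L-lipschitz_on (cball x 1) f" and k: "L-lipschitz_on (cball x 1) k"
  shows "\<forall>\<^sub>F h in at_right 0. \<forall>y\<in>cball x 1. \<forall>z\<in>cball x 1.
    implicit_step f k h x y \<longrightarrow> implicit_step f k h x z \<longrightarrow> y = z"
proof -
  have "\<forall>\<^sub>F h in at_right 0. 1 * h \<le> (1::real)" "\<forall>\<^sub>F h in at_right 0. 2 * L * h \<le> 1 / 2"
    "\<forall>\<^sub>F h in at_right 0. 0 < (h::real)"
    by (intro eventually_at_right_0_mult_le eventually_at_right_less; simp)+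
  then show ?thesis
  proof eventually_elim
    case (elim h)
    show ?case
    proof (intro ballI impI)
      fix y z assume yz: "y \<in> cball x 1" "z \<in> cball x 1"
        and s: "implicit_step f k h x y" "implicit_step f k h x z"
      have "dist y z \<le> 2 * L * h * dist y z"
        using implicit_step_contraction[OF f k _ _ yz, of h] s elim
        unfolding implicit_step_def by simp
      also have "\<dots> \<le> 1 / 2 * dist y z"
        using elim by (intro mult_right_mono) auto
      finally show "y = z" by simp
    qed
  qed
qed

text \<open>For small h the contraction factor is at most 1/2 and the displacement at most 1, so
  Banach's theorem applies in the closed unit ball. The O(h) distance makes the solutions converge
  to \<open>x\<close>, as a branch requires.\<close>

lemma implicit_step_exists:
  fixes f k :: "'a::banach \<Rightarrow> 'a"
  assumes f: "L-lipschitz_on (cball x 1) f" and k: "L-lipschitz_on (cball x 1) k"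
  shows "\<forall>\<^sub>F h in at_right 0. \<exists>y. implicit_step f k h x y \<and> dist y x \<le> (norm (f x) + 2 * L) * h"
proof -
  let ?C = "norm (f x) + 2 * L"
  have "\<forall>\<^sub>F h in at_right 0. 1 * h \<le> (1::real)" "\<forall>\<^sub>F h in at_right 0. 2 * L * h \<le> 1 / 2"
    "\<forall>\<^sub>F h in at_right 0. ?C * h \<le> 1"
    "\<forall>\<^sub>F h in at_right 0. 0 < (h::real)"
    by (intro eventually_at_right_0_mult_le eventually_at_right_less; simp)+
  then show ?thesis
  proof eventually_elim
    case (elim h)
    let ?G = "\<lambda>y. x + (h / 2) *\<^sub>R (f x + f y) + h\<^sup>2 *\<^sub>R (k y - k x)"
    note c = implicit_step_contraction[OF f k] implicit_step_displacement[OF f k]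
    have L: "L \<ge> 0" using f lipschitz_on_nonneg by auto
    have "\<exists>!y\<in>cball x 1. ?G y = y"
    proof (rule Banach_fix[of _ "1/2"])
      show "?G ` cball x 1 \<subseteq> cball x 1"
        using c(2)[of h] elim by (fastforce simp: dist_commute)
      show "dist (?G y) (?G z) \<le> 1 / 2 * dist y z" if "y \<in> cball x 1" "z \<in> cball x 1" for y z
      proof -
        have "dist (?G y) (?G z) \<le> 2 * L * h * dist y z" using c(1) that elim by auto
        also have "\<dots> \<le> 1 / 2 * dist y z"
          using elim by (intro mult_right_mono) auto
        finally show ?thesis .
      qed
    qed (auto simp: complete_eq_closed)
    then obtain y where y: "y \<in> cball x 1" "?G y = y" by blast
    then have "dist y x \<le> ?C * h" using c(2)[of h y] elim by simp
    then show ?case using y unfolding implicit_step_def by metis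
  qed
qed

text \<open>Integration gains one power. The mean value inequality on {0..s} is used with the bound
  at the right end, so the constant stays C instead of improving to C / (n + 1).\<close>

lemma primitive_power_bound:
  fixes y :: "real \<Rightarrow> 'a::real_normed_vector"
  assumes "\<And>s. s \<in> {0..T} \<Longrightarrow> (y has_vector_derivative y' s) (at s within {0..T})"
    and "\<And>s. s \<in> {0..T} \<Longrightarrow> norm (y' s) \<le> C * s ^ n"
    and "s \<in> {0..T}"
  shows "norm (y s - y 0) \<le> C * s ^ (n + 1)"
proof (cases "s = 0")
  case False
  then have s: "s > 0" using assms(3) by auto
  have "0 \<le> C * s ^ n" using assms(2)[OF assms(3)] by (rule order_trans[OF norm_ge_zero])
  then have C: "C \<ge> 0" using s by (metis mult_neg_pos not_le zero_less_power)
  have "norm (y s - y 0) \<le> C * s ^ n * norm (s - 0)"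
  proof (rule differentiable_bound[of "{0..s}" y "\<lambda>u d. d *\<^sub>R y' u"])
    fix u assume u: "u \<in> {0..s}"
    show "(y has_derivative (\<lambda>d. d *\<^sub>R y' u)) (at u within {0..s})"
      using assms(1)[of u] assms(3) u
      by (auto simp: has_vector_derivative_def intro: has_derivative_subset)
    have "onorm (\<lambda>d. d *\<^sub>R y' u) = norm (y' u)"
      by (simp add: onorm_scaleR_left bounded_linear_ident onorm_id)
    also have "\<dots> \<le> C * u ^ n" using assms u by auto
    also have "\<dots> \<le> C * s ^ n" using u C by (intro mult_left_mono power_mono) auto
    finally show "onorm (\<lambda>d. d *\<^sub>R y' u) \<le> C * s ^ n" .
  qed (use s in auto)
  then show ?thesis using s by (simp add: mult_ac)
qed simp

text \<open>Bootstrapping: a bound on the displacement \<open>d\<close> gives one on the increment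
  of the field by bilinearity, and integrating that gives a better one on \<open>d\<close>. Two
  rounds after the initial bound O(s) reach the order s^3.\<close>

lemma trapezoidal_defect:
  fixes y :: "real \<Rightarrow> 'a::real_normed_vector"
  assumes Q: "bounded_bilinear Q"
    and y: "\<And>s. s \<in> {0..T} \<Longrightarrow> (y has_vector_derivative Q (y s) (y s)) (at s within {0..T})"
  shows "\<exists>C\<ge>0. \<forall>s\<in>{0..T}. norm (y s - y 0) \<le> C * s \<and>
    norm (y s - y 0 - (s / 2) *\<^sub>R (Q (y 0) (y 0) + Q (y s) (y s))) \<le> C * s ^ 3"
proof -
  interpret Q: bounded_bilinear Q by (rule Q)
  obtain K where K: "K \<ge> 0" "\<And>a b. norm (Q a b) \<le> norm a * norm b * K"
    using Q.nonneg_bounded by blast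
  define f where "f = (\<lambda>v. Q v v)"
  define d where "d = (\<lambda>s. y s - y 0)"
  \<comment> \<open>The derivative of the field along the solution at 0, by the product
    rule.\<close>
  define D where "D = Q (f (y 0)) (y 0) + Q (y 0) (f (y 0))"
  have cy: "continuous_on {0..T} y"
    using has_vector_derivative_continuous[OF y] by (auto simp: continuous_on_eq_continuous_within)
  then have "compact ((\<lambda>s. f (y s)) ` {0..T})"
    unfolding f_def by (intro compact_continuous_image Q.continuous_on) auto
  then obtain C1 where C1: "C1 > 0" "\<And>s. s \<in> {0..T} \<Longrightarrow> norm (f (y s)) \<le> C1"
    by (force dest: compact_imp_bounded simp: bounded_pos)
  have d1: "norm (d s) \<le> C1 * s" if "s \<in> {0..T}" for s
    using primitive_power_bound[of T y "\<lambda>s. f (y s)" C1 0 s] y C1 that by (simp add: d_def f_def)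
  have f_eq: "f (y s) - f (y 0) = Q (d s) (y 0) + Q (y 0) (d s) + Q (d s) (d s)" for s
    by (simp add: f_def d_def Q.diff_left Q.diff_right algebra_simps)
  define C2 where "C2 = (2 * C1 * norm (y 0) + C1 * (C1 * T)) * K"
  have f1: "norm (f (y s) - f (y 0)) \<le> C2 * s" if s: "s \<in> {0..T}" for s
  proof -
    have "norm (f (y s) - f (y 0)) \<le>
        norm (d s) * norm (y 0) * K + norm (y 0) * norm (d s) * K + norm (d s) * norm (d s) * K"
      unfolding f_eq by (intro norm_triangle_le add_mono K)
    \<comment> \<open>In the quadratic term one factor is bounded by \<open>C1 * T\<close> rather
      than \<open>C1 * s\<close>, so that everything is linear in s.\<close>
    also have "\<dots> \<le> (C1 * s) * norm (y 0) * K + norm (y 0) * (C1 * s) * K + (C1 * s) * (C1 * T) * K"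
    proof -
      have "norm (d s) \<le> C1 * T"
        using d1[OF s] s C1 by (auto intro: order_trans mult_left_mono)
      then show ?thesis using d1[OF s] K C1 s by (intro add_mono mult_mono) auto
    qed
    finally show ?thesis by (simp add: C2_def algebra_simps)
  qed
  have d2: "norm (d s - s *\<^sub>R f (y 0)) \<le> C2 * s ^ 2" if "s \<in> {0..T}" for s
  proof -
    have "norm ((d s - s *\<^sub>R f (y 0)) - (d 0 - 0 *\<^sub>R f (y 0))) \<le> C2 * s ^ (1 + 1)"
    proof (rule primitive_power_bound[where T = T])
      fix s assume s: "s \<in> {0..T}"
      show "((\<lambda>s. d s - s *\<^sub>R f (y 0)) has_vector_derivative f (y s) - f (y 0)) (at s within {0..T})"
        unfolding d_def using y[OF s]
        by (auto intro!: derivative_eq_intros simp: f_def)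
    qed (use f1 that in auto)
    then show ?thesis by (simp add: d_def power2_eq_square)
  qed
  define C3 where "C3 = (2 * C2 * norm (y 0) + C1 * C1) * K"
  have f2: "norm (f (y s) - f (y 0) - s *\<^sub>R D) \<le> C3 * s ^ 2" if s: "s \<in> {0..T}" for s
  proof -
    let ?e = "d s - s *\<^sub>R f (y 0)"
    have "f (y s) - f (y 0) - s *\<^sub>R D = Q ?e (y 0) + Q (y 0) ?e + Q (d s) (d s)"
      unfolding f_eq by (simp add: D_def Q.diff_left Q.diff_right Q.scaleR_left Q.scaleR_right
          scaleR_add_right)
    also have "norm \<dots> \<le>
        norm ?e * norm (y 0) * K + norm (y 0) * norm ?e * K + norm (d s) * norm (d s) * K"
      by (intro norm_triangle_le add_mono K)
    also have "\<dots> \<le> (C2 * s^2) * norm (y 0) * K + norm (y 0) * (C2 * s^2) * K + (C1 * s) * (C1 * s) * K"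
      using d1[OF s] d2[OF s] K C1 s order_trans[OF norm_ge_zero d2[OF s]]
      by (intro add_mono mult_mono) auto
    finally show ?thesis by (simp add: C3_def algebra_simps power2_eq_square)
  qed
  have d3: "norm (d s - s *\<^sub>R f (y 0) - (s\<^sup>2 / 2) *\<^sub>R D) \<le> C3 * s ^ 3" if "s \<in> {0..T}" for s
  proof -
    have "norm ((d s - s *\<^sub>R f (y 0) - (s\<^sup>2 / 2) *\<^sub>R D) - (d 0 - 0 *\<^sub>R f (y 0) - (0\<^sup>2 / 2) *\<^sub>R D))
        \<le> C3 * s ^ (2 + 1)"
    proof (rule primitive_power_bound[where T = T])
      fix s assume s: "s \<in> {0..T}"
      show "((\<lambda>s. d s - s *\<^sub>R f (y 0) - (s\<^sup>2 / 2) *\<^sub>R D) has_vector_derivative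
          f (y s) - f (y 0) - s *\<^sub>R D) (at s within {0..T})"
        unfolding d_def using y[OF s]
        by (auto intro!: derivative_eq_intros simp: f_def)
    qed (use f2 that in auto)
    then show ?thesis by (simp add: d_def)
  qed
  have "norm (y s - y 0 - (s / 2) *\<^sub>R (f (y 0) + f (y s))) \<le> C3 * s ^ 3 + C3 / 2 * s ^ 3"
    if s: "s \<in> {0..T}" for s
  proof -
    \<comment> \<open>The two terms s^2/2 D cancel; this cancellation is what makes the trapezoidal
      rule second order.\<close>
    have "y s - y 0 - (s / 2) *\<^sub>R (f (y 0) + f (y s)) =
        (d s - s *\<^sub>R f (y 0) - (s\<^sup>2 / 2) *\<^sub>R D) - (s / 2) *\<^sub>R (f (y s) - f (y 0) - s *\<^sub>R D)"
    proof -
      have "s *\<^sub>R f (y 0) = (s/2) *\<^sub>R f (y 0) + (s/2) *\<^sub>R f (y 0)" by (simp flip: scaleR_add_left)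
      then show ?thesis by (simp add: d_def algebra_simps power2_eq_square)
    qed
    also have "norm \<dots> \<le> C3 * s ^ 3 + (s / 2) * (C3 * s^2)"
      using d3[OF s] f2[OF s] s
      by - (rule order_trans[OF norm_triangle_ineq4 add_mono]; auto intro: mult_left_mono)
    finally show ?thesis by (simp add: algebra_simps power2_eq_square power3_eq_cube)
  qed
  note final = this
  define C where "C = max C1 (2 * \<bar>C3\<bar>)"
  show ?thesis
  proof (intro exI[of _ C] conjI ballI)
    fix s assume s: "s \<in> {0..T}"
    have "C1 * s \<le> C * s" using s by (intro mult_right_mono) (auto simp: C_def)
    then show "norm (y s - y 0) \<le> C * s" using d1[OF s] by (simp add: d_def)
    have "C3 * s ^ 3 + C3 / 2 * s ^ 3 \<le> C * s ^ 3"
      unfolding distrib_right[symmetric] using s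
      by (intro mult_right_mono) (auto simp: C_def)
    then show "norm (y s - y 0 - (s / 2) *\<^sub>R (Q (y 0) (y 0) + Q (y s) (y s))) \<le> C * s ^ 3"
      using final[OF s] by (simp add: f_def)
  qed (use C1 in \<open>auto simp: C_def\<close>)
qed

text \<open>Subtracting the step from the exact solution leaves three terms: the trapezoidal defect,
  a multiple of the error itself that is absorbed on the left, and h^2 times an increment of
  \<open>k\<close>, which is O(h) by the displacement bound.\<close>

lemma implicit_step_local_error:
  fixes Q :: "'a::real_normed_vector \<Rightarrow> 'a \<Rightarrow> 'a"
  assumes Q: "bounded_bilinear Q" and T: "T > 0"
    and f: "L-lipschitz_on (cball (y 0) 1) (\<lambda>v. Q v v)" and k: "L-lipschitz_on (cball (y 0) 1) k"
    and y: "\<And>s. s \<in> {0..T} \<Longrightarrow> (y has_vector_derivative Q (y s) (y s)) (at s within {0..T})"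
    and X: "(X \<longlongrightarrow> y 0) (at_right 0)"
      "\<forall>\<^sub>F h in at_right 0. implicit_step (\<lambda>v. Q v v) k h (y 0) (X h)"
  shows "(\<lambda>h. norm (y h - X h)) \<in> O[at_right 0](\<lambda>h. h ^ 3)"
proof -
  let ?f = "\<lambda>v. Q v v"
  obtain C where C: "C \<ge> 0" "\<And>s. s \<in> {0..T} \<Longrightarrow> norm (y s - y 0) \<le> C * s"
    "\<And>s. s \<in> {0..T} \<Longrightarrow>
      norm (y s - y 0 - (s / 2) *\<^sub>R (?f (y 0) + ?f (y s))) \<le> C * s ^ 3"
    using trapezoidal_defect[OF Q y] by blast
  let ?C = "norm (?f (y 0)) + 2 * L"
  have L: "L \<ge> 0" using f lipschitz_on_nonneg by auto
  have "\<forall>\<^sub>F h in at_right 0. 1 * h \<le> (1::real)" "\<forall>\<^sub>F h in at_right 0. 1 * h \<le> T"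
    "\<forall>\<^sub>F h in at_right 0. L * h \<le> 1" "\<forall>\<^sub>F h in at_right 0. C * h \<le> 1"
    "\<forall>\<^sub>F h in at_right 0. 0 < (h::real)"
    using T by (intro eventually_at_right_0_mult_le eventually_at_right_less; simp)+
  moreover have "\<forall>\<^sub>F h in at_right 0. dist (X h) (y 0) < 1"
    using X(1) by (rule tendstoD) simp
  ultimately have "\<forall>\<^sub>F h in at_right 0. norm (norm (y h - X h)) \<le> (2 * (C + L * ?C)) * norm (h ^ 3)"
    using X(2)
  proof eventually_elim
    case (elim h)
    have h: "h \<in> {0..T}" using elim by simp
    have Xh: "X h \<in> cball (y 0) 1" using elim by (simp add: dist_commute)
    have yh: "y h \<in> cball (y 0) 1"
      using C(2)[OF h] elim by (simp add: dist_norm norm_minus_commute)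
    have "dist (X h) (y 0) \<le> ?C * h"
      using implicit_step_displacement[OF f k _ _ Xh, of h] elim
      unfolding implicit_step_def by simp
    moreover have "norm (k (X h) - k (y 0)) \<le> L * dist (X h) (y 0)"
      using k Xh by (auto simp: lipschitz_on_def dist_norm)
    ultimately have kX: "norm (k (X h) - k (y 0)) \<le> L * (?C * h)"
      using L by (meson mult_left_mono order_trans)
    have fX: "norm (?f (y h) - ?f (X h)) \<le> L * norm (y h - X h)"
      using f Xh yh by (auto simp: lipschitz_on_def dist_norm)
    have "y h - X h = (y h - y 0 - (h / 2) *\<^sub>R (?f (y 0) + ?f (y h)))
        + (h / 2) *\<^sub>R (?f (y h) - ?f (X h)) - h\<^sup>2 *\<^sub>R (k (X h) - k (y 0))"
      using elim by (simp add: implicit_step_def algebra_simps)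
    also have "norm \<dots> \<le> C * h ^ 3 + (h / 2) * (L * norm (y h - X h)) + h\<^sup>2 * (L * (?C * h))"
      using C(3)[OF h] kX fX elim
      by - (rule order_trans[OF norm_triangle_ineq4 add_mono[OF order_trans[OF norm_triangle_ineq add_mono]]];
          auto intro: mult_left_mono)
    \<comment> \<open>Since L h is at most 1, this term is at most half of the error; moving it to
      the left produces the factor 2 below.\<close>
    also have "(h / 2) * (L * norm (y h - X h)) = (L * h) * (norm (y h - X h) / 2)" by simp
    also have "\<dots> \<le> 1 * (norm (y h - X h) / 2)" using elim by (intro mult_right_mono) auto
    finally have "norm (y h - X h) \<le> 2 * (C * h ^ 3 + h\<^sup>2 * (L * (?C * h)))" by simp
    also have "\<dots> = (2 * (C + L * ?C)) * h ^ 3"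
      by (simp add: algebra_simps power2_eq_square power3_eq_cube)
    finally show ?case using elim by simp
  qed
  then show ?thesis by (rule bigoI)
qed

section \<open>Shift of the time origin, and inverses of square matrices\<close>

lemma has_vector_derivative_shift_interval:
  fixes f :: "real \<Rightarrow> 'a::real_normed_vector"
  assumes "(f has_vector_derivative D) (at (t0 + s) within {t0..t0 + T})"
  shows "((\<lambda>s. f (t0 + s)) has_vector_derivative D) (at s within {0..T})"
proof -
  have "((\<lambda>s. t0 + s) has_vector_derivative 1) (at s within {0..T})"
    by (auto intro!: derivative_eq_intros)
  moreover have "(\<lambda>s. t0 + s) ` {0..T} = {t0..t0 + T}"
    by (simp add: add.commute)
  ultimately have "(f \<circ> (\<lambda>s. t0 + s) has_vector_derivative 1 *\<^sub>R D) (at s within {0..T})"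
    using assms by (intro vector_diff_chain_within) (simp_all add: add.commute)
  then show ?thesis by (simp add: o_def)
qed

lemma matrix_inv_mult:
  assumes "invertible A"
  shows "matrix_inv A ** A = mat 1" "A ** matrix_inv A = mat 1"
  using someI_ex[OF assms[unfolded invertible_def]] by (simp_all add: matrix_inv_def)

lemma matrix_inv_unique:
  fixes A B :: "real^'n^'n"
  assumes "B ** A = mat 1"
  shows "matrix_inv A = B"
proof -
  have AB: "A ** B = mat 1" using assms by (simp add: matrix_left_right_inverse)
  then have "A ** matrix_inv A = mat 1"
    using assms by (intro matrix_inv_mult) (auto simp: invertible_def)
  then show ?thesis by (metis assms matrix_mul_assoc matrix_mul_lid matrix_mul_rid)
qed

section \<open>The reduced method\<close>

definition spatial :: "real^2 \<Rightarrow> real^3" where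
  "spatial v = vector [v$1, v$2, 0]"

lemma spatial_nth [simp]: "spatial v $ 1 = v $ 1" "spatial v $ 2 = v $ 2" "spatial v $ 3 = 0"
  by (simp_all add: spatial_def)

lemma planar_nth [simp]: "planar w $ 1 = w $ 1" "planar w $ 2 = w $ 2"
  by (simp_all add: planar_def)

lemma planar_spatial [simp]: "planar (spatial v) = v"
  by (simp add: vec_eq_iff forall_2)

lemma spatial_planar: "w $ 3 = 0 \<Longrightarrow> spatial (planar w) = w"
  by (simp add: vec_eq_iff forall_3)

lemma bounded_linear_planar: "bounded_linear planar"
  unfolding linear_conv_bounded_linear[symmetric] linear_iff
  by (simp add: vec_eq_iff forall_2)

lemma bounded_linear_spatial: "bounded_linear spatial"
  unfolding linear_conv_bounded_linear[symmetric] linear_iff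
  by (simp add: vec_eq_iff forall_3)

lemma norm_planar: "w $ 3 = 0 \<Longrightarrow> norm (planar w) = norm w"
  by (simp add: norm_eq_sqrt_inner inner_vec_def sum_2 sum_3)

lemma planar_row_eq: "planar_row I j w = I$j$1 * w$1 + I$j$2 * w$2"
proof -
  have "(1::3) \<noteq> 2" by simp
  then show ?thesis by (simp add: planar_row_def)
qed

lemma inertia_block_mult: "inertia_block I *v v = vector [planar_row I 1 (spatial v), planar_row I 2 (spatial v)]"
  by (simp add: vec_eq_iff forall_2 inertia_block_def matrix_vector_mult_def sum_2 planar_row_eq)

text \<open>M(omega) is the rank-one matrix u u^T with u the planar part of omega.\<close>

lemma M_matrix_mult: "M_matrix w *v x = (planar w \<bullet> x) *\<^sub>R planar w"
  by (simp add: vec_eq_iff forall_2 M_matrix_def matrix_vector_mult_def sum_2 inner_vec_def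
      algebra_simps power2_eq_square)

text \<open>Positive definiteness passes to a principal block: on vectors embedded with third
  component 0 both quadratic forms agree.\<close>

lemma invertible_inertia_block:
  assumes "inertia_tensor I"
  shows "invertible (inertia_block I)"
proof -
  have "v = 0" if v: "inertia_block I *v v = 0" for v
  proof (rule ccontr)
    assume "v \<noteq> 0"
    then have "spatial v \<noteq> 0" by (metis planar_spatial bounded_linear_planar linear_simps(3))
    then have "0 < (I *v spatial v) \<bullet> spatial v" using assms by (simp add: inertia_tensor_def)
    also have "(I *v spatial v) \<bullet> spatial v = (inertia_block I *v v) \<bullet> v"
      unfolding inertia_block_mult
      by (simp add: planar_row_eq inner_vec_def matrix_vector_mult_def sum_2 sum_3)
    finally show False using v by simp
  qed
  then show ?thesis
    by (simp add: invertible_left_inverse matrix_left_invertible_ker)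
qed

text \<open>Polarised right-hand side of the reduced equation: \<open>u\<close> enters through the
  third momentum component and \<open>v\<close> through the rotated velocity. The two slots are kept
  apart so that the estimates for bilinear maps apply.\<close>

definition suslov_form :: "real^3^3 \<Rightarrow> real^2 \<Rightarrow> real^2 \<Rightarrow> real^2" where
  "suslov_form I u v =
     - (matrix_inv (inertia_block I) *v (planar_row I 3 (spatial u) *\<^sub>R vector [v$2, - (v$1)]))"

text \<open>The M-terms of the scheme, solved for the new velocity: the factor 1/4 comes from h^2/4,
  the sign from moving them to the right-hand side.\<close>

definition suslov_correction :: "real^3^3 \<Rightarrow> real^2 \<Rightarrow> real^2" where
  "suslov_correction I u =
     - (1 / 4) *\<^sub>R (matrix_inv (inertia_block I) *v ((u \<bullet> (inertia_block I *v u)) *\<^sub>R u))"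

abbreviation suslov_field :: "real^3^3 \<Rightarrow> real^2 \<Rightarrow> real^2" where
  "suslov_field I u \<equiv> suslov_form I u u"

lemma bounded_bilinear_suslov_form: "bounded_bilinear (suslov_form I)"
proof -
  let ?P = "\<lambda>u v::real^2. planar_row I 3 (spatial u) *\<^sub>R (vector [v$2, - (v$1)] :: real^2)"
  have "bilinear ?P"
    by (simp add: bilinear_def linear_iff vec_eq_iff forall_2 planar_row_eq algebra_simps)
  then have "bilinear (suslov_form I)"
    unfolding bilinear_def linear_iff suslov_form_def
    by (simp only: matrix_vector_right_distrib matrix_vector_mult_scaleR minus_add_distrib
        scaleR_minus_right simp_thms)
  then show ?thesis by (simp add: bilinear_conv_bounded_bilinear)
qed

lemma suslov_field_lipschitz: "\<exists>L. L-lipschitz_on (cball x r) (suslov_field I)"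
  using bounded_bilinear.lipschitz_on_prod[OF bounded_bilinear_suslov_form compact_cball
      lipschitz_on_id lipschitz_on_id] .

lemma suslov_correction_lipschitz: "\<exists>L. L-lipschitz_on (cball x r) (suslov_correction I)"
proof -
  let ?S = "cball x r"
  obtain A where "A-lipschitz_on ?S ((*v) (inertia_block I))"
    using bounded_linear.lipschitz_boundE[OF matrix_vector_mul_bounded_linear] by blast
  then obtain B where "B-lipschitz_on ?S (\<lambda>u. u \<bullet> (inertia_block I *v u))"
    using bounded_bilinear.lipschitz_on_prod[OF bounded_bilinear_inner compact_cball lipschitz_on_id]
    by blast
  then obtain C where C: "C-lipschitz_on ?S (\<lambda>u. (u \<bullet> (inertia_block I *v u)) *\<^sub>R u)"
    using bounded_bilinear.lipschitz_on_prod[OF bounded_bilinear_scaleR compact_cball _ lipschitz_on_id]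
    by blast
  obtain D where "D-lipschitz_on ((\<lambda>u. (u \<bullet> (inertia_block I *v u)) *\<^sub>R u) ` ?S)
      (\<lambda>v. - (1 / 4) *\<^sub>R (matrix_inv (inertia_block I) *v v))"
    using bounded_linear.lipschitz_boundE[OF bounded_linear_const_scaleR[OF matrix_vector_mul_bounded_linear]]
    by blast
  from lipschitz_on_compose2[OF C this] show ?thesis
    unfolding suslov_correction_def[abs_def] by blast
qed

lemma suslov_lipschitz:
  obtains L where "L-lipschitz_on (cball x 1) (suslov_field I)"
    "L-lipschitz_on (cball x 1) (suslov_correction I)"
proof -
  obtain A B where "A-lipschitz_on (cball x 1) (suslov_field I)"
    "B-lipschitz_on (cball x 1) (suslov_correction I)"
    using suslov_field_lipschitz suslov_correction_lipschitz by blast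
  then show thesis
    by (intro that[of "max A B"]) (auto elim: lipschitz_on_mono)
qed

definition suslov_scheme_multiplier :: "real^3^3 \<Rightarrow> real^3 \<Rightarrow> real^3 \<Rightarrow> real" where
  "suslov_scheme_multiplier I w w' =
     (1/2) * (w'$1 * planar_row I 2 w' + w$1 * planar_row I 2 w)
         - (1/2) * (w'$2 * planar_row I 1 w' + w$2 * planar_row I 1 w)"

text \<open>Multiplying the implicit equation by the inverse of the inertia block turns it into
  \<open>implicit_step\<close>, an equivalence because the block is invertible. The multiplier is an
  explicit function of both velocities, so existence and uniqueness of the step concern only the
  planar velocity.\<close>

lemma suslov_scheme_iff:
  assumes "inertia_tensor I"
  shows "suslov_scheme I h w w' l \<longleftrightarrow> w $ 3 = 0 \<and> w' $ 3 = 0 \<and>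
    implicit_step (suslov_field I) (suslov_correction I) h (planar w) (planar w') \<and>
    l = suslov_scheme_multiplier I w w'"
proof -
  define B where "B = inertia_block I"
  define B' where "B' = matrix_inv B"
  have inv: "B' ** B = mat 1" "B ** B' = mat 1"
    using matrix_inv_mult[OF invertible_inertia_block[OF assms]] by (simp_all add: B_def B'_def)
  define g where "g u = planar_row I 3 (spatial u) *\<^sub>R (vector [u$2, - (u$1)] :: real^2)" for u :: "real^2"
  define m where "m u = (u \<bullet> (B *v u)) *\<^sub>R u" for u
  define u u' where "u = planar w" and "u' = planar w'"
  define E where "E = B *v (u' - u) + (h / 2) *\<^sub>R (g u' + g u) + (h\<^sup>2 / 4) *\<^sub>R m u' - (h\<^sup>2 / 4) *\<^sub>R m u"
  have gv: "vector [w'$2 * planar_row I 3 w' + w$2 * planar_row I 3 w,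
      - (w'$1 * planar_row I 3 w') - w$1 * planar_row I 3 w] = g u' + g u"
    by (simp add: vec_eq_iff forall_2 g_def u_def u'_def planar_row_eq mult.commute)
  have "B' *v E = u' - u + (h / 2) *\<^sub>R (B' *v g u' + B' *v g u)
      + (h\<^sup>2 / 4) *\<^sub>R (B' *v m u') - (h\<^sup>2 / 4) *\<^sub>R (B' *v m u)"
    unfolding E_def
    by (simp add: matrix_vector_mult_diff_distrib matrix_vector_right_distrib matrix_vector_mult_scaleR
        matrix_vector_mul_assoc inv)
  also have "\<dots> = u' - (u + (h / 2) *\<^sub>R (suslov_field I u + suslov_field I u')
      + h\<^sup>2 *\<^sub>R (suslov_correction I u' - suslov_correction I u))"
    by (simp add: suslov_form_def suslov_correction_def g_def m_def B'_def B_def algebra_simps)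
  finally have "implicit_step (suslov_field I) (suslov_correction I) h u u' \<longleftrightarrow> B' *v E = 0"
    by (simp add: implicit_step_def)
  also have "\<dots> \<longleftrightarrow> E = 0"
    by (metis inv(2) matrix_vector_mul_assoc matrix_vector_mul_lid matrix_vector_mult_0_right)
  finally show ?thesis
    unfolding suslov_scheme_def gv M_matrix_mult suslov_scheme_multiplier_def
    by (simp add: E_def m_def u_def u'_def B_def)
qed

lemma well_defined_step_suslov_scheme:
  assumes I: "inertia_tensor I" and w: "w $ 3 = 0"
  shows "well_defined_step (suslov_scheme I) w"
  unfolding well_defined_step_def
proof (intro conjI allI impI)
  let ?step = "implicit_step (suslov_field I) (suslov_correction I)"
  obtain L where L: "L-lipschitz_on (cball (planar w) 1) (suslov_field I)"
    "L-lipschitz_on (cball (planar w) 1) (suslov_correction I)"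
    by (rule suslov_lipschitz)
  define C where "C = norm (suslov_field I (planar w)) + 2 * L"
  \<comment> \<open>The choice is meaningful only for small h; its values elsewhere do not affect
    the limit at 0 from the right.\<close>
  define Y where "Y h = (SOME y. ?step h (planar w) y \<and> dist y (planar w) \<le> C * h)" for h
  have Y: "\<forall>\<^sub>F h in at_right 0. ?step h (planar w) (Y h) \<and> dist (Y h) (planar w) \<le> C * h"
    using implicit_step_exists[OF L] unfolding Y_def C_def by eventually_elim (rule someI_ex)
  have "((\<lambda>h. C * h) \<longlongrightarrow> C * 0) (at_right 0)" by (intro tendsto_intros)
  then have lim: "((\<lambda>h. C * h) \<longlongrightarrow> 0) (at_right 0)" by simp
  have ev: "\<forall>\<^sub>F h in at_right 0. dist (Y h) (planar w) \<le> C * h"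
    using Y by eventually_elim simp
  have "((\<lambda>h. dist (Y h) (planar w)) \<longlongrightarrow> 0) (at_right 0)"
    by (rule tendsto_sandwich[OF _ ev tendsto_const lim]) simp
  then have "(Y \<longlongrightarrow> planar w) (at_right 0)" by (rule tendsto_dist_iff[THEN iffD2])
  then have "((\<lambda>h. spatial (Y h)) \<longlongrightarrow> spatial (planar w)) (at_right 0)"
    by (rule bounded_linear.tendsto[OF bounded_linear_spatial])
  moreover have "\<forall>\<^sub>F h in at_right 0. suslov_scheme I h w (spatial (Y h))
      (suslov_scheme_multiplier I w (spatial (Y h)))"
    using Y by eventually_elim (simp add: suslov_scheme_iff[OF I] w)
  ultimately show "\<exists>X \<Lambda>. step_branch (suslov_scheme I) w X \<Lambda>"
    unfolding step_branch_def by (auto simp: spatial_planar w)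
next
  fix X \<Lambda> X' \<Lambda>'
  obtain L where L: "L-lipschitz_on (cball (planar w) 1) (suslov_field I)"
    "L-lipschitz_on (cball (planar w) 1) (suslov_correction I)"
    by (rule suslov_lipschitz)
  assume b: "step_branch (suslov_scheme I) w X \<Lambda>" "step_branch (suslov_scheme I) w X' \<Lambda>'"
  \<comment> \<open>Convergence to the old state brings every branch into the ball in which
    solutions are unique.\<close>
  have near: "\<forall>\<^sub>F h in at_right 0. planar (Z h) \<in> cball (planar w) 1"
    if "step_branch (suslov_scheme I) w Z M" for Z M
  proof -
    have "((\<lambda>h. planar (Z h)) \<longlongrightarrow> planar w) (at_right 0)"
      using that by (intro bounded_linear.tendsto[OF bounded_linear_planar]) (simp add: step_branch_def)
    then have "\<forall>\<^sub>F h in at_right 0. dist (planar (Z h)) (planar w) < 1" by (rule tendstoD) simp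
    then show ?thesis by eventually_elim (simp add: dist_commute)
  qed
  have "\<forall>\<^sub>F h in at_right 0. suslov_scheme I h w (X h) (\<Lambda> h)"
    "\<forall>\<^sub>F h in at_right 0. suslov_scheme I h w (X' h) (\<Lambda>' h)"
    using b by (simp_all add: step_branch_def)
  then show "\<forall>\<^sub>F h in at_right 0. X h = X' h \<and> \<Lambda> h = \<Lambda>' h"
    using near[OF b(1)] near[OF b(2)] implicit_step_unique[OF L]
  proof eventually_elim
    case (elim h)
    then have "planar (X h) = planar (X' h)" by (simp add: suslov_scheme_iff[OF I])
    then have "X h = X' h" using elim by (metis suslov_scheme_iff[OF I] spatial_planar)
    then show ?case using elim by (simp add: suslov_scheme_iff[OF I])
  qed
qed

lemma suslov_solution_planar:
  assumes I: "inertia_tensor I" and T: "T > 0"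
    and sol: "suslov_solution I {t0..t0 + T} \<omega> lam" and s: "s \<in> {0..T}"
  shows "((\<lambda>s. planar (\<omega> (t0 + s))) has_vector_derivative suslov_field I (planar (\<omega> (t0 + s))))
    (at s within {0..T})"
proof -
  let ?J = "{t0..t0 + T}" and ?t = "t0 + s"
  obtain \<omega>' where \<omega>': "\<And>t. t \<in> ?J \<Longrightarrow> (\<omega> has_vector_derivative \<omega>' t) (at t within ?J)"
    "\<And>t. t \<in> ?J \<Longrightarrow> I *v \<omega>' t = cross3 (I *v \<omega> t) (\<omega> t) + lam t *\<^sub>R e3"
    "\<And>t. t \<in> ?J \<Longrightarrow> \<omega> t $ 3 = 0"
    using sol unfolding suslov_solution_def by blast
  have t: "?t \<in> ?J" using s by simp
  \<comment> \<open>The constraint holds on a nondegenerate interval and can be differentiated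
    there, also at the endpoints. Hence the third column of \<open>I\<close> drops out of the first
    two equations.\<close>
  have "((\<lambda>t. \<omega> t $ 3) has_vector_derivative \<omega>' ?t $ 3) (at ?t within ?J)"
    by (rule bounded_linear.has_vector_derivative[OF bounded_linear_vec_nth \<omega>'(1)[OF t]])
  moreover have "((\<lambda>t. \<omega> t $ 3) has_vector_derivative 0) (at ?t within ?J)"
    by (rule has_vector_derivative_transform[OF t _ has_vector_derivative_const]) (simp add: \<omega>'(3))
  ultimately have d3: "\<omega>' ?t $ 3 = 0"
    using vector_derivative_unique_within_closed_interval[of t0 "t0 + T" ?t] T t by auto
  let ?u = "planar (\<omega> ?t)"
  have "inertia_block I *v planar (\<omega>' ?t) =
      - (planar_row I 3 (spatial ?u) *\<^sub>R (vector [?u$2, - (?u$1)] :: real^2))"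
    using \<omega>'(2)[OF t] \<omega>'(3)[OF t] d3
    unfolding inertia_block_mult
    by (simp add: planar_row_eq vec_eq_iff forall_2 forall_3 cross3_def e3_def
        axis_def matrix_vector_mult_def sum_3 algebra_simps)
  then have "matrix_inv (inertia_block I) *v (inertia_block I *v planar (\<omega>' ?t)) = suslov_field I ?u"
    by (simp add: suslov_form_def linear_neg)
  then have eq: "planar (\<omega>' ?t) = suslov_field I ?u"
    using matrix_inv_mult(1)[OF invertible_inertia_block[OF I]] by (simp add: matrix_vector_mul_assoc)
  have "((\<lambda>t. planar (\<omega> t)) has_vector_derivative planar (\<omega>' ?t)) (at ?t within ?J)"
    by (rule bounded_linear.has_vector_derivative[OF bounded_linear_planar \<omega>'(1)[OF t]])
  from has_vector_derivative_shift_interval[OF this] show ?thesis by (simp add: eq)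
qed

lemma suslov_velocity_order_scheme:
  assumes I: "inertia_tensor I"
  shows "suslov_velocity_order I (suslov_scheme I) 2"
  unfolding suslov_velocity_order_def
proof (intro allI impI)
  fix t0 T :: real and \<omega> lam W \<Lambda>
  assume T: "0 < T" and sol: "suslov_solution I {t0..t0 + T} \<omega> lam"
    and b: "step_branch (suslov_scheme I) (\<omega> t0) W \<Lambda>"
  let ?y = "\<lambda>s. planar (\<omega> (t0 + s))"
  obtain L where L: "L-lipschitz_on (cball (?y 0) 1) (suslov_field I)"
    "L-lipschitz_on (cball (?y 0) 1) (suslov_correction I)"
    by (rule suslov_lipschitz)
  have ev: "\<forall>\<^sub>F h in at_right 0. suslov_scheme I h (\<omega> t0) (W h) (\<Lambda> h)" "(W \<longlongrightarrow> \<omega> t0) (at_right 0)"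
    using b by (auto simp: step_branch_def)
  have "(\<lambda>h. norm (?y h - planar (W h))) \<in> O[at_right 0](\<lambda>h. h ^ 3)"
  proof (rule implicit_step_local_error[where y = ?y, OF bounded_bilinear_suslov_form T L
        suslov_solution_planar[OF I T sol]])
    show "((\<lambda>h. planar (W h)) \<longlongrightarrow> ?y 0) (at_right 0)"
      using bounded_linear.tendsto[OF bounded_linear_planar ev(2)] by simp
    show "\<forall>\<^sub>F h in at_right 0. implicit_step (suslov_field I) (suslov_correction I) h (?y 0) (planar (W h))"
      using ev(1) by eventually_elim (simp add: suslov_scheme_iff[OF I])
  qed
  moreover have "\<forall>\<^sub>F h in at_right 0. norm (?y h - planar (W h)) = norm (\<omega> (t0 + h) - W h)"
    using ev(1) eventually_at_right_less[of 0] eventually_at_right_0_mult_le[OF T, of 1]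
  proof eventually_elim
    case (elim h)
    then have "\<omega> (t0 + h) $ 3 = 0" "W h $ 3 = 0"
      using sol by (auto simp: suslov_solution_def suslov_scheme_def)
    then have "norm (planar (\<omega> (t0 + h) - W h)) = norm (\<omega> (t0 + h) - W h)"
      by (intro norm_planar) simp
    moreover have "planar (\<omega> (t0 + h) - W h) = planar (\<omega> (t0 + h)) - planar (W h)"
      by (simp add: vec_eq_iff forall_2)
    ultimately show ?case by simp
  qed
  ultimately show "(\<lambda>h. norm (\<omega> (t0 + h) - W h)) \<in> O[at_right 0](\<lambda>h. h ^ (2 + 1))"
    using landau_o.big.in_cong by fastforce
qed

section \<open>A Suslov problem with inconsistent multiplier\<close>

text \<open>The planar block is the identity, so the multiplier formula of the scheme vanishes,
  while the entry 1 at (3, 1) keeps the missing term omega_1' alive. The entry 2 ensures positive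
  definiteness: the form is (x1 + x3)^2 + x2^2 + x3^2.\<close>

definition oblique_inertia :: "real^3^3" where
  "oblique_inertia = vector [vector [1, 0, 1], vector [0, 1, 0], vector [1, 0, 2]]"

lemma oblique_inertia_nth [simp]:
  "oblique_inertia $ 1 $ 1 = 1" "oblique_inertia $ 1 $ 2 = 0" "oblique_inertia $ 1 $ 3 = 1"
  "oblique_inertia $ 2 $ 1 = 0" "oblique_inertia $ 2 $ 2 = 1" "oblique_inertia $ 2 $ 3 = 0"
  "oblique_inertia $ 3 $ 1 = 1" "oblique_inertia $ 3 $ 2 = 0" "oblique_inertia $ 3 $ 3 = 2"
  by (simp_all add: oblique_inertia_def)

lemma inertia_tensor_oblique_inertia: "inertia_tensor oblique_inertia"
  unfolding inertia_tensor_def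
proof (intro conjI allI impI)
  show "transpose oblique_inertia = oblique_inertia"
    by (simp add: transpose_def vec_eq_iff forall_3)
next
  fix x :: "real^3" assume "x \<noteq> 0"
  have eq: "(oblique_inertia *v x) \<bullet> x = (x$1 + x$3)\<^sup>2 + (x$2)\<^sup>2 + (x$3)\<^sup>2"
    by (simp add: matrix_vector_mult_def inner_vec_def sum_3 power2_eq_square algebra_simps)
  show "0 < (oblique_inertia *v x) \<bullet> x"
  proof (rule ccontr)
    assume "\<not> 0 < (oblique_inertia *v x) \<bullet> x"
    then have "(x$1 + x$3)\<^sup>2 + (x$2)\<^sup>2 + (x$3)\<^sup>2 = 0"
      using eq by (smt (verit) zero_le_power2)
    then have "x$3 = 0" "x$2 = 0" "x$1 + x$3 = 0"
      by (smt (verit) zero_le_power2 power2_eq_iff_nonneg zero_eq_power2)+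
    then show False using \<open>x \<noteq> 0\<close> by (simp add: vec_eq_iff forall_3)
  qed
qed

text \<open>The reduced equations are omega_1' = - omega_1 omega_2 and omega_2' = omega_1^2, solved
  here on the unit circle; the third equation reduces to lambda = omega_1'.\<close>

lemma suslov_solution_oblique_inertia:
  "suslov_solution oblique_inertia J (\<lambda>t. vector [1 / cosh t, tanh t, 0])
    (\<lambda>t. - (sinh t / (cosh t)\<^sup>2))"
  unfolding suslov_solution_def
proof (intro exI ballI conjI)
  fix t :: real assume "t \<in> J"
  have eq: "(vector [a, b, 0] :: real^3) = a *\<^sub>R axis 1 1 + b *\<^sub>R axis 2 1" for a b
    by (simp add: vec_eq_iff forall_3 axis_def)
  have f: "((\<lambda>t. 1 / cosh t) has_real_derivative - (sinh t / (cosh t)\<^sup>2)) (at t within J)"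
    by (auto intro!: derivative_eq_intros simp: power2_eq_square)
  have "1 + (sinh t)\<^sup>2 \<noteq> 0"
    by (simp add: add_nonneg_eq_0_iff)
  then have g: "(tanh has_real_derivative 1 / (cosh t)\<^sup>2) (at t within J)"
    by (auto intro!: derivative_eq_intros simp: tanh_def divide_simps cosh_square_eq algebra_simps)
  show "((\<lambda>t. vector [1 / cosh t, tanh t, 0] :: real^3) has_vector_derivative
      vector [- (sinh t / (cosh t)\<^sup>2), 1 / (cosh t)\<^sup>2, 0]) (at t within J)"
    using has_vector_derivative_add[OF
        has_vector_derivative_scaleR[OF f has_vector_derivative_const[of "axis 1 1 :: real^3"]]
        has_vector_derivative_scaleR[OF g has_vector_derivative_const[of "axis 2 1 :: real^3"]]]
    unfolding eq by simp
qed (simp_all add: vec_eq_iff forall_3 matrix_vector_mult_def sum_3 cross3_def e3_def axis_def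
      tanh_def power2_eq_square)

lemma suslov_scheme_oblique_inertia_multiplier:
  "suslov_scheme oblique_inertia h w w' l \<Longrightarrow> l = 0"
  by (simp add: suslov_scheme_def planar_row_eq)

text \<open>An O(h) error would force the exact multiplier to tend to the numerical value 0. The
  step starts at time 1 because at time 0 the exact multiplier vanishes and the error would be
  O(h).\<close>

lemma not_suslov_multiplier_order_oblique_inertia:
  "\<not> suslov_multiplier_order oblique_inertia (suslov_scheme oblique_inertia) 0"
proof
  let ?\<omega> = "\<lambda>t. vector [1 / cosh t, tanh t, 0] :: real^3"
  let ?lam = "\<lambda>t. - (sinh t / (cosh t)\<^sup>2) :: real"
  assume order: "suslov_multiplier_order oblique_inertia (suslov_scheme oblique_inertia) 0"
  have "well_defined_step (suslov_scheme oblique_inertia) (?\<omega> 1)"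
    by (rule well_defined_step_suslov_scheme[OF inertia_tensor_oblique_inertia]) simp
  then obtain W \<Lambda> where W: "step_branch (suslov_scheme oblique_inertia) (?\<omega> 1) W \<Lambda>"
    unfolding well_defined_step_def by blast
  have "(\<lambda>h. \<bar>?lam (1 + h) - \<Lambda> h\<bar>) \<in> O[at_right 0](\<lambda>h. h ^ (0 + 1))"
    by (rule order[unfolded suslov_multiplier_order_def, rule_format, OF zero_less_one
          suslov_solution_oblique_inertia W])
  then obtain C where "\<forall>\<^sub>F h in at_right 0. \<bar>?lam (1 + h) - \<Lambda> h\<bar> \<le> C * \<bar>h\<bar>"
    by (auto elim!: landau_o.bigE)
  moreover have "\<forall>\<^sub>F h in at_right 0. \<Lambda> h = 0"
    using conjunct1[OF W[unfolded step_branch_def]]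
    by eventually_elim (rule suslov_scheme_oblique_inertia_multiplier)
  ultimately have ev: "\<forall>\<^sub>F h in at_right 0. norm (?lam (1 + h)) \<le> C * \<bar>h\<bar>"
    by eventually_elim simp
  have "((\<lambda>h. C * \<bar>h\<bar>) \<longlongrightarrow> C * \<bar>0\<bar>) (at_right 0)"
    by (intro tendsto_intros)
  then have "((\<lambda>h. C * \<bar>h\<bar>) \<longlongrightarrow> 0) (at_right 0)" by simp
  from Lim_null_comparison[OF ev this]
  have "((\<lambda>h. ?lam (1 + h)) \<longlongrightarrow> 0) (at_right 0)" .
  moreover have "((\<lambda>h. ?lam (1 + h)) \<longlongrightarrow> ?lam (1 + 0)) (at_right 0)"
    by (intro tendsto_intros) simp
  ultimately have "?lam (1 + 0) = 0"
    by (rule tendsto_unique[OF trivial_limit_at_right_real, rotated])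
  then show False by simp
qed

section \<open>From the Lagrange-d'Alembert principle to the Suslov problem\<close>

lemma bounded_bilinear_matrix_matrix_mult:
  "bounded_bilinear ((**) :: real^'n^'m \<Rightarrow> real^'p^'n \<Rightarrow> real^'p^'m)"
proof -
  have "bilinear ((**) :: real^'n^'m \<Rightarrow> real^'p^'n \<Rightarrow> real^'p^'m)"
    by (simp add: bilinear_def linear_iff matrix_matrix_mult_def vec_eq_iff sum.distrib
        sum_distrib_left algebra_simps)
  then show ?thesis by (simp add: bilinear_conv_bounded_bilinear)
qed

interpretation matrix_mult: bounded_bilinear "(**) :: real^'n^'m \<Rightarrow> real^'p^'n \<Rightarrow> real^'p^'m"
  by (rule bounded_bilinear_matrix_matrix_mult)

lemma bounded_linear_transpose: "bounded_linear (transpose :: real^'n^'m \<Rightarrow> real^'m^'n)"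
  unfolding linear_conv_bounded_linear[symmetric] linear_iff
  by (simp add: vec_eq_iff transpose_def)

lemma bounded_linear_vee: "bounded_linear vee"
  unfolding linear_conv_bounded_linear[symmetric] linear_iff
  by (simp add: vec_eq_iff vee_def forall_3)

lemma bounded_linear_hat: "bounded_linear hat"
  unfolding linear_conv_bounded_linear[symmetric] linear_iff hat_def
  by (simp add: vec_eq_iff matrix_def cross3_def forall_3 axis_def algebra_simps)

lemma matrix_inv_orthogonal: "orthogonal_matrix Q \<Longrightarrow> matrix_inv Q = transpose Q"
  for Q :: "real^'n^'n"
  by (intro matrix_inv_unique) (simp add: orthogonal_matrix)

text \<open>Rotations commute with the cross product: E^T (w x E x') = (E^T w) x x' for every vector
  x'.\<close>

lemma rotation_conjugate_hat:
  assumes "rotation_matrix E"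
  shows "transpose E ** hat w ** E = hat (transpose E *v w)"
proof -
  have EE: "transpose E ** E = mat 1" "E ** transpose E = mat 1"
    using assms by (simp_all add: rotation_matrix_def orthogonal_matrix_def)
  have rt: "rotation_matrix (transpose E)"
    using assms by (simp add: rotation_matrix_def)
  have "(transpose E ** hat w ** E) *v x = hat (transpose E *v w) *v x" for x
  proof -
    have "(transpose E ** hat w ** E) *v x = transpose E *v (cross3 w (E *v x))"
      by (simp add: hat_works flip: matrix_vector_mul_assoc)
    also have "\<dots> = cross3 (transpose E *v w) (transpose E *v (E *v x))"
      by (rule cross_rotation_matrix[OF rt, symmetric])
    also have "\<dots> = hat (transpose E *v w) *v x"
      by (simp add: hat_works matrix_vector_mul_assoc EE)
    finally show ?thesis .
  qed
  then show ?thesis by (simp add: matrix_eq)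
qed

lemma hat_nth:
  "hat w $ 1 $ 1 = 0" "hat w $ 1 $ 2 = - w $ 3" "hat w $ 1 $ 3 = w $ 2"
  "hat w $ 2 $ 1 = w $ 3" "hat w $ 2 $ 2 = 0" "hat w $ 2 $ 3 = - w $ 1"
  "hat w $ 3 $ 1 = - w $ 2" "hat w $ 3 $ 2 = w $ 1" "hat w $ 3 $ 3 = 0"
  by (simp_all add: hat_def matrix_def cross3_def axis_def)

lemma transpose_hat: "transpose (hat w) = - hat w"
  by (simp add: vec_eq_iff forall_3 transpose_def hat_nth)

text \<open>Rodrigues' formula for the exponential of theta times the hat of a basis vector.
  Coordinate axes suffice, since the equation of motion is tested componentwise.\<close>

definition axis_rotation :: "3 \<Rightarrow> real \<Rightarrow> real^3^3" where
  "axis_rotation i \<theta> = mat 1 + sin \<theta> *\<^sub>R hat (axis i 1)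
     + (1 - cos \<theta>) *\<^sub>R (hat (axis i 1) ** hat (axis i 1))"

lemma hat_axis_cube: "hat (axis i 1) ** hat (axis i 1) ** hat (axis i 1) = - hat (axis i 1)"
  using exhaust_3[of i]
  by (auto simp: vec_eq_iff forall_3 matrix_matrix_mult_def sum_3 hat_nth axis_def)

lemma axis_rotation_0 [simp]: "axis_rotation i 0 = mat 1"
  by (simp add: axis_rotation_def)

lemma rotation_matrix_axis_rotation: "rotation_matrix (axis_rotation i \<theta>)"
proof -
  have sc: "sin \<theta> * sin \<theta> = 1 - cos \<theta> * cos \<theta>"
    by (metis sin_squared_eq power2_eq_square)
  show ?thesis
    unfolding rotation_matrix_def orthogonal_matrix
    using exhaust_3[of i]
    by (auto simp: axis_rotation_def vec_eq_iff forall_3 matrix_matrix_mult_def sum_3 hat_nth axis_def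
        transpose_def mat_def det_3 algebra_simps sc)
qed

text \<open>The relation N^3 = -N turns the derivative of Rodrigues' formula into E N, the equation
  of a one-parameter group.\<close>

lemma has_vector_derivative_axis_rotation:
  "(axis_rotation i has_vector_derivative axis_rotation i \<theta> ** hat (axis i 1)) (at \<theta> within S)"
proof -
  let ?N = "hat (axis i 1)"
  have "(axis_rotation i has_vector_derivative cos \<theta> *\<^sub>R ?N + sin \<theta> *\<^sub>R (?N ** ?N)) (at \<theta> within S)"
    unfolding axis_rotation_def[abs_def] by (auto intro!: derivative_eq_intros)
  also have "cos \<theta> *\<^sub>R ?N + sin \<theta> *\<^sub>R (?N ** ?N) = axis_rotation i \<theta> ** ?N"
    by (simp add: axis_rotation_def matrix_mult.add_left matrix_mult.scaleR_left hat_axis_cube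
        matrix_mult.diff_left scaleR_diff_left)
  finally show ?thesis .
qed

text \<open>With Q a primitive of \<open>q\<close>, the test function whose derivative is p - Q - c
  is admissible once c is the mean of p - Q. Testing with it forces the integral of (p - Q - c)^2 to
  vanish, hence p = Q + c.\<close>

lemma du_bois_reymond:
  fixes p q :: "real \<Rightarrow> real"
  assumes ab: "a < b" and p: "continuous_on {a..b} p" and q: "continuous_on {a..b} q"
    and weak: "\<And>\<phi> \<phi>'. (\<And>t. t \<in> {a..b} \<Longrightarrow> (\<phi> has_real_derivative \<phi>' t) (at t within {a..b})) \<Longrightarrow>
      continuous_on {a..b} \<phi>' \<Longrightarrow> \<phi> a = 0 \<Longrightarrow> \<phi> b = 0 \<Longrightarrow>
      integral {a..b} (\<lambda>t. \<phi>' t * p t + \<phi> t * q t) = 0"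
    and t: "t \<in> {a..b}"
  shows "(p has_real_derivative q t) (at t within {a..b})"
proof -
  define Q where "Q t = integral {a..t} q" for t
  have Q: "(Q has_real_derivative q t) (at t within {a..b})" if "t \<in> {a..b}" for t
    unfolding Q_def[abs_def] by (rule integral_has_real_derivative[OF q that])
  have cQ: "continuous_on {a..b} Q"
    using Q DERIV_continuous_on by blast
  \<comment> \<open>The mean value is chosen so that the test function vanishes at \<open>b\<close>
    as well.\<close>
  define c where "c = integral {a..b} (\<lambda>t. p t - Q t) / (b - a)"
  define \<phi>' where "\<phi>' t = p t - Q t - c" for t
  define \<phi> where "\<phi> t = integral {a..t} \<phi>'" for t
  have c\<phi>': "continuous_on {a..b} \<phi>'"
    unfolding \<phi>'_def[abs_def] using p cQ by (intro continuous_intros)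
  have \<phi>: "(\<phi> has_real_derivative \<phi>' t) (at t within {a..b})" if "t \<in> {a..b}" for t
    unfolding \<phi>_def[abs_def] by (rule integral_has_real_derivative[OF c\<phi>' that])
  have c\<phi>: "continuous_on {a..b} \<phi>"
    using \<phi> DERIV_continuous_on by blast
  have \<phi>a: "\<phi> a = 0" by (simp add: \<phi>_def)
  have \<phi>b: "\<phi> b = 0"
  proof -
    have "\<phi> b = integral {a..b} (\<lambda>t. p t - Q t) - integral {a..b} (\<lambda>t. c)"
      unfolding \<phi>_def \<phi>'_def using p cQ
      by (intro integral_diff integrable_continuous_interval continuous_intros)
    then show ?thesis using ab by (simp add: c_def)
  qed
  have parts: "((\<lambda>t. \<phi>' t * Q t + \<phi> t * q t) has_integral \<phi> b * Q b - \<phi> a * Q a) {a..b}"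
  proof (rule fundamental_theorem_of_calculus)
    fix t assume t: "t \<in> {a..b}"
    have "((\<lambda>t. \<phi> t * Q t) has_real_derivative \<phi>' t * Q t + \<phi> t * q t) (at t within {a..b})"
      using DERIV_mult[OF \<phi>[OF t] Q[OF t]] by (simp add: algebra_simps)
    then show "((\<lambda>t. \<phi> t * Q t) has_vector_derivative \<phi>' t * Q t + \<phi> t * q t) (at t within {a..b})"
      by (simp add: has_real_derivative_iff_has_vector_derivative)
  qed (use ab in simp)
  have mean: "((\<lambda>t. c * \<phi>' t) has_integral c * (\<phi> b - \<phi> a)) {a..b}"
  proof (rule has_integral_mult_right, rule fundamental_theorem_of_calculus)
    show "(\<phi> has_vector_derivative \<phi>' t) (at t within {a..b})" if "t \<in> {a..b}" for t
      using \<phi>[OF that] by (simp add: has_real_derivative_iff_has_vector_derivative)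
  qed (use ab in simp)
  have "((\<lambda>t. \<phi>' t * p t + \<phi> t * q t) has_integral 0) {a..b}"
  proof -
    have "(\<lambda>t. \<phi>' t * p t + \<phi> t * q t) integrable_on {a..b}"
      using p q c\<phi>' c\<phi> by (intro integrable_continuous_interval continuous_intros)
    then show ?thesis
      using weak[OF \<phi> c\<phi>' \<phi>a \<phi>b] by (metis integrable_integral)
  qed
  \<comment> \<open>Subtracting both zero integrals leaves \<phi>' (p - Q - c), which is the square
    of \<phi>'.\<close>
  from has_integral_diff[OF has_integral_diff[OF this parts] mean]
  have zero: "((\<lambda>t. (\<phi>' t)\<^sup>2) has_integral 0) {a..b}"
    by (simp add: \<phi>a \<phi>b \<phi>'_def algebra_simps power2_eq_square)
  have \<phi>'0: "\<phi>' t = 0" if t: "t \<in> {a..b}" for t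
  proof -
    have "(\<phi>' t)\<^sup>2 = 0"
      using has_integral_0_cbox_imp_0[of a b "\<lambda>t. (\<phi>' t)\<^sup>2" t] zero ab t c\<phi>'
      by (auto intro!: continuous_intros)
    then show ?thesis by simp
  qed
  have "((\<lambda>t. Q t + c) has_real_derivative q t) (at t within {a..b})"
    using Q[OF t] by (auto intro!: derivative_eq_intros)
  moreover have "Q x + c = p x" if "x \<in> {a..b}" for x
    using \<phi>'0[OF that] by (simp add: \<phi>'_def)
  ultimately show ?thesis
    by (rule has_field_derivative_transform_within[OF _ zero_less_one t])
qed

section \<open>Variations of a curve of rotations about a fixed body axis\<close>

lemma rotation_matrix_mult: "rotation_matrix A \<Longrightarrow> rotation_matrix B \<Longrightarrow> rotation_matrix (A ** B)"
  for A B :: "real^'n^'n"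
  by (simp add: rotation_matrix_def orthogonal_matrix_mul det_mul)

lemma rotation_matrix_transpose_mult:
  "rotation_matrix A \<Longrightarrow> transpose A ** A = mat 1" "rotation_matrix A \<Longrightarrow> A ** transpose A = mat 1"
  by (simp_all add: rotation_matrix_def orthogonal_matrix_def)

lemma matrix_inv_rotation: "rotation_matrix Q \<Longrightarrow> matrix_inv Q = transpose Q"
  for Q :: "real^'n^'n"
  by (simp add: rotation_matrix_def matrix_inv_orthogonal)

lemma continuous_on_axis_rotation [continuous_intros]:
  fixes f :: "'a::t2_space \<Rightarrow> real"
  shows "continuous_on S f \<Longrightarrow> continuous_on S (\<lambda>x. axis_rotation i (f x))"
  unfolding axis_rotation_def by (intro continuous_intros)

lemmas continuous_on_matrix_mult [continuous_intros] =
  bounded_bilinear.continuous_on[OF bounded_bilinear_matrix_matrix_mult]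

lemmas has_vector_derivative_matrix_mult =
  bounded_bilinear.has_vector_derivative[OF bounded_bilinear_matrix_matrix_mult]

lemma has_vector_derivative_axis_rotation_compose:
  assumes "(f has_real_derivative f') (at x within S)"
  shows "((\<lambda>x. axis_rotation i (f x)) has_vector_derivative
    f' *\<^sub>R (axis_rotation i (f x) ** hat (axis i 1))) (at x within S)"
  using vector_diff_chain_within[OF assms[unfolded has_real_derivative_iff_has_vector_derivative]
      has_vector_derivative_axis_rotation, of i]
  by (simp add: o_def)

text \<open>Right multiplication by rotations stays in SO(3), and zeros of \<open>\<phi>\<close> fix
  the endpoints. The mixed derivative contains \<open>\<phi>\<close>, \<open>\<phi>'\<close> and
  \<open>V\<close> but no second derivative of \<open>\<phi>\<close>, so the test functions built in
  \<open>du_bois_reymond\<close> are smooth enough.\<close>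

lemma SO3_variation_axis:
  fixes R V :: "real \<Rightarrow> real^3^3" and \<phi> \<phi>' :: "real \<Rightarrow> real" and i :: 3
  assumes R: "\<And>t. t \<in> {a..b} \<Longrightarrow> rotation_matrix (R t)"
    "\<And>t. t \<in> {a..b} \<Longrightarrow> (R has_vector_derivative V t) (at t within {a..b})"
    and V: "continuous_on {a..b} V"
    and \<phi>: "\<And>t. t \<in> {a..b} \<Longrightarrow> (\<phi> has_real_derivative \<phi>' t) (at t within {a..b})"
      "continuous_on {a..b} \<phi>'" "\<phi> a = 0" "\<phi> b = 0"
  defines "N \<equiv> hat (axis i 1)"
  defines "E \<equiv> \<lambda>s t. axis_rotation i (s * \<phi> t)"
  shows "SO3_variation a b R (\<lambda>s t. R t ** E s t)
    (\<lambda>s t. \<phi> t *\<^sub>R (R t ** (E s t ** N)))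
    (\<lambda>s t. V t ** E s t + (s * \<phi>' t) *\<^sub>R (R t ** (E s t ** N)))"
proof -
  have Es: "((\<lambda>s. E s t) has_vector_derivative \<phi> t *\<^sub>R (E s t ** N)) (at s)" for s t
    unfolding E_def N_def
    by (rule has_vector_derivative_axis_rotation_compose) (auto intro!: derivative_eq_intros)
  have Et: "((\<lambda>t. E s t) has_vector_derivative (s * \<phi>' t) *\<^sub>R (E s t ** N)) (at t within {a..b})"
    if "t \<in> {a..b}" for s t
    unfolding E_def N_def
    by (rule has_vector_derivative_axis_rotation_compose)
      (use \<phi>(1)[OF that] in \<open>auto intro!: derivative_eq_intros\<close>)
  have EsN: "((\<lambda>s. E s t ** N) has_vector_derivative \<phi> t *\<^sub>R (E s t ** N ** N)) (at s)" for s t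
    using has_vector_derivative_matrix_mult[OF Es has_vector_derivative_const[of N]]
    by (simp add: matrix_mult.scaleR_left matrix_mult.zero_right)
  have EtN: "((\<lambda>t. E s t ** N) has_vector_derivative (s * \<phi>' t) *\<^sub>R (E s t ** N ** N)) (at t within {a..b})"
    if "t \<in> {a..b}" for s t
    using has_vector_derivative_matrix_mult[OF Et[OF that] has_vector_derivative_const[of N]]
    by (simp add: matrix_mult.scaleR_left matrix_mult.zero_right)
  let ?J = "Sigma {-1<..<1::real} (\<lambda>_. {a..b})"
  have cR: "continuous_on {a..b} R"
    using has_vector_derivative_continuous[OF R(2)] by (auto simp: continuous_on_eq_continuous_within)
  have c\<phi>: "continuous_on {a..b} \<phi>"
    using \<phi>(1) DERIV_continuous_on by blast
  have snd: "continuous_on ?J (\<lambda>p. g (snd p))" if "continuous_on {a..b} g" for g :: "real \<Rightarrow> 'z::topological_space"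
    by (rule continuous_on_compose2[OF that continuous_on_snd[OF continuous_on_id]]) auto
  note cont = snd[OF cR] snd[OF V] snd[OF c\<phi>] snd[OF \<phi>(2)]
  show ?thesis
    unfolding SO3_variation_def
  proof (intro conjI ballI exI[of _ "\<lambda>s t. \<phi> t *\<^sub>R (V t ** (E s t ** N))
        + \<phi>' t *\<^sub>R (R t ** (E s t ** N)) + (s * \<phi>' t * \<phi> t) *\<^sub>R (R t ** (E s t ** N ** N))"])
    fix s :: real and t assume t: "t \<in> {a..b}"
    show "rotation_matrix (R t ** E s t)"
      using R(1)[OF t] by (simp add: E_def rotation_matrix_mult rotation_matrix_axis_rotation)
    show "((\<lambda>s. R t ** E s t) has_vector_derivative \<phi> t *\<^sub>R (R t ** (E s t ** N))) (at s)"
      using has_vector_derivative_matrix_mult[OF has_vector_derivative_const Es]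
      by (simp add: matrix_mult.scaleR_right matrix_mult.zero_left)
    show "((\<lambda>t. R t ** E s t) has_vector_derivative
        V t ** E s t + (s * \<phi>' t) *\<^sub>R (R t ** (E s t ** N))) (at t within {a..b})"
      using has_vector_derivative_matrix_mult[OF R(2)[OF t] Et[OF t]]
      by (simp add: matrix_mult.scaleR_right add.commute)
    have "((\<lambda>s. V t ** E s t) has_vector_derivative \<phi> t *\<^sub>R (V t ** (E s t ** N))) (at s)"
      using has_vector_derivative_matrix_mult[OF has_vector_derivative_const Es]
      by (simp add: matrix_mult.scaleR_right matrix_mult.zero_left)
    moreover have "((\<lambda>s. R t ** (E s t ** N)) has_vector_derivative \<phi> t *\<^sub>R (R t ** (E s t ** N ** N))) (at s)"
      using has_vector_derivative_matrix_mult[OF has_vector_derivative_const EsN]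
      by (simp add: matrix_mult.scaleR_right matrix_mult.zero_left)
    then have "((\<lambda>s. (s * \<phi>' t) *\<^sub>R (R t ** (E s t ** N))) has_vector_derivative
        (s * \<phi>' t) *\<^sub>R \<phi> t *\<^sub>R (R t ** (E s t ** N ** N)) + \<phi>' t *\<^sub>R (R t ** (E s t ** N))) (at s)"
      by (intro has_vector_derivative_scaleR) (auto intro!: derivative_eq_intros)
    ultimately show "((\<lambda>s. V t ** E s t + (s * \<phi>' t) *\<^sub>R (R t ** (E s t ** N))) has_vector_derivative
        \<phi> t *\<^sub>R (V t ** (E s t ** N))
        + \<phi>' t *\<^sub>R (R t ** (E s t ** N)) + (s * \<phi>' t * \<phi> t) *\<^sub>R (R t ** (E s t ** N ** N))) (at s)"
      using has_vector_derivative_add by (fastforce simp: algebra_simps)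
    have "((\<lambda>t. R t ** (E s t ** N)) has_vector_derivative
        R t ** ((s * \<phi>' t) *\<^sub>R (E s t ** N ** N)) + V t ** (E s t ** N)) (at t within {a..b})"
      by (rule has_vector_derivative_matrix_mult[OF R(2)[OF t] EtN[OF t]])
    from has_vector_derivative_scaleR[OF \<phi>(1)[OF t] this]
    show "((\<lambda>t. \<phi> t *\<^sub>R (R t ** (E s t ** N))) has_vector_derivative
        \<phi> t *\<^sub>R (V t ** (E s t ** N))
        + \<phi>' t *\<^sub>R (R t ** (E s t ** N)) + (s * \<phi>' t * \<phi> t) *\<^sub>R (R t ** (E s t ** N ** N)))
        (at t within {a..b})"
      by (simp add: matrix_mult.scaleR_right algebra_simps)
  next
    show "continuous_on ?J (\<lambda>(s, t). \<phi> t *\<^sub>R (R t ** (E s t ** N)))"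
      "continuous_on ?J (\<lambda>(s, t). V t ** E s t + (s * \<phi>' t) *\<^sub>R (R t ** (E s t ** N)))"
      "continuous_on ?J (\<lambda>(s, t). \<phi> t *\<^sub>R (V t ** (E s t ** N))
        + \<phi>' t *\<^sub>R (R t ** (E s t ** N)) + (s * \<phi>' t * \<phi> t) *\<^sub>R (R t ** (E s t ** N ** N)))"
      unfolding case_prod_beta E_def by (intro continuous_intros cont)+
  qed (auto simp: E_def \<phi>)
qed

section \<open>First variation of the action\<close>

lemma constraint_distribution_velocity:
  assumes "rotation_matrix R" "V \<in> constraint_distribution R"
  defines "w \<equiv> vee (matrix_inv R ** V)"
  shows "V = R ** hat w" "w $ 3 = 0"
proof -
  obtain u where u: "V = R ** hat u" "u $ 3 = 0"
    using assms(2) by (auto simp: constraint_distribution_def)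
  have "w = u"
    by (simp add: w_def u(1) matrix_inv_rotation[OF assms(1)] matrix_mul_assoc
        rotation_matrix_transpose_mult[OF assms(1)])
  then show "V = R ** hat w" "w $ 3 = 0" using u by simp_all
qed

text \<open>For a product R E the body velocity is that of \<open>R\<close>, rotated into the new
  frame by E^T, plus that of \<open>E\<close>; here the velocity of E is c E hat(n).\<close>

lemma body_velocity_variation:
  assumes R: "rotation_matrix R" and E: "rotation_matrix E"
  shows "vee (matrix_inv (R ** E) ** ((R ** hat w) ** E + c *\<^sub>R (R ** (E ** hat n))))
    = transpose E *v w + c *\<^sub>R n"
proof -
  have "matrix_inv (R ** E) ** ((R ** hat w) ** E + c *\<^sub>R (R ** (E ** hat n)))
      = transpose E ** (transpose R ** R) ** hat w ** E
        + c *\<^sub>R (transpose E ** (transpose R ** R) ** E ** hat n)"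
    by (simp add: matrix_inv_rotation rotation_matrix_mult R E matrix_transpose_mul
        matrix_mult.add_right matrix_mult.scaleR_right matrix_mul_assoc)
  also have "\<dots> = hat (transpose E *v w) + c *\<^sub>R hat n"
    by (simp add: rotation_matrix_transpose_mult R E rotation_conjugate_hat)
  also have "\<dots> = hat (transpose E *v w + c *\<^sub>R n)"
    by (simp add: linear_simps[OF bounded_linear_hat])
  finally show ?thesis by simp
qed

lemma inertia_tensor_inner: "inertia_tensor I \<Longrightarrow> (I *v x) \<bullet> y = x \<bullet> (I *v y)"
  by (metis dot_lmul_matrix vector_transpose_matrix inertia_tensor_def)

lemma invertible_inertia_tensor:
  assumes "inertia_tensor I"
  shows "invertible I"
proof -
  have "x = 0" if "I *v x = 0" for x
    using assms that unfolding inertia_tensor_def by (metis inner_zero_left less_irrefl)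
  then show ?thesis
    by (simp add: invertible_left_inverse matrix_left_invertible_ker)
qed

lemma lagrange_dalembert_continuous:
  assumes sol: "lagrange_dalembert_solution I a b R V lam"
  shows "continuous_on {a..b} R" "continuous_on {a..b} V" "continuous_on {a..b} lam"
    "continuous_on {a..b} (\<lambda>t. vee (matrix_inv (R t) ** V t))"
proof -
  obtain A where A: "\<And>t. t \<in> {a..b} \<Longrightarrow> (R has_vector_derivative V t) (at t within {a..b})"
    "\<And>t. t \<in> {a..b} \<Longrightarrow> (V has_vector_derivative A t) (at t within {a..b})"
    and rot: "\<And>t. t \<in> {a..b} \<Longrightarrow> rotation_matrix (R t)"
    and lam: "continuous_on {a..b} lam"
    using sol unfolding lagrange_dalembert_solution_def by blast
  show cR: "continuous_on {a..b} R"
    using has_vector_derivative_continuous[OF A(1)] by (auto simp: continuous_on_eq_continuous_within)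
  show cV: "continuous_on {a..b} V"
    using has_vector_derivative_continuous[OF A(2)] by (auto simp: continuous_on_eq_continuous_within)
  show "continuous_on {a..b} lam" by (rule lam)
  have "continuous_on {a..b} (\<lambda>t. vee (transpose (R t) ** V t))"
    using cR cV
    by (intro bounded_linear.continuous_on[OF bounded_linear_vee] continuous_on_matrix_mult
        bounded_linear.continuous_on[OF bounded_linear_transpose])
  then show "continuous_on {a..b} (\<lambda>t. vee (matrix_inv (R t) ** V t))"
    by (rule continuous_on_eq) (simp add: matrix_inv_rotation rot)
qed

text \<open>The derivative of the action at s = 0 is obtained twice, from the principle and by
  differentiation under the integral; uniqueness of derivatives equates the two.\<close>

lemma lagrange_dalembert_weak_form:
  fixes i :: 3 and \<phi> \<phi>' :: "real \<Rightarrow> real"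
  assumes I: "inertia_tensor I"
    and sol: "lagrange_dalembert_solution I a b R V lam"
    and \<phi>: "\<And>t. t \<in> {a..b} \<Longrightarrow> (\<phi> has_real_derivative \<phi>' t) (at t within {a..b})"
      "continuous_on {a..b} \<phi>'" "\<phi> a = 0" "\<phi> b = 0"
  defines "\<omega> \<equiv> \<lambda>t. vee (matrix_inv (R t) ** V t)"
  shows "integral {a..b} (\<lambda>t. \<phi>' t * (I *v \<omega> t) $ i
    + \<phi> t * (cross3 (I *v \<omega> t) (\<omega> t) + lam t *\<^sub>R e3) $ i) = 0"
proof -
  define n :: "real^3" where "n = axis i 1"
  define E where "E s t = axis_rotation i (s * \<phi> t)" for s t
  define X where "X s t = R t ** E s t" for s t
  define Xs where "Xs s t = \<phi> t *\<^sub>R (R t ** (E s t ** hat n))" for s t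
  define Xt where "Xt s t = V t ** E s t + (s * \<phi>' t) *\<^sub>R (R t ** (E s t ** hat n))" for s t
  note cont = lagrange_dalembert_continuous[OF sol, folded \<omega>_def]
  have rot: "\<And>t. t \<in> {a..b} \<Longrightarrow> rotation_matrix (R t)"
    and con: "\<And>t. t \<in> {a..b} \<Longrightarrow> V t \<in> constraint_distribution (R t)"
    and der: "\<And>t. t \<in> {a..b} \<Longrightarrow> (R has_vector_derivative V t) (at t within {a..b})"
    and var: "\<And>X Xs Xt. SO3_variation a b R X Xs Xt \<Longrightarrow>
        ((\<lambda>s. integral {a..b} (\<lambda>t. lagrangian I (X s t) (Xt s t))) has_real_derivative
          - integral {a..b} (\<lambda>t. lam t * constraint_form (R t) (Xs 0 t))) (at 0)"
    using sol unfolding lagrange_dalembert_solution_def by blast+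
  have V: "V t = R t ** hat (\<omega> t)" if "t \<in> {a..b}" for t
    using constraint_distribution_velocity(1)[OF rot[OF that] con[OF that]] by (simp add: \<omega>_def)
  have c\<phi>: "continuous_on {a..b} \<phi>"
    using \<phi>(1) DERIV_continuous_on by blast
  \<comment> \<open>Body velocity of the varied curve; \<open>ws\<close> below is its derivative in
    s.\<close>
  define w where "w s t = transpose (E s t) *v \<omega> t + (s * \<phi>' t) *\<^sub>R n" for s t
  define ws where "ws s t = \<phi> t *\<^sub>R (transpose (E s t ** hat n) *v \<omega> t) + \<phi>' t *\<^sub>R n" for s t
  have "SO3_variation a b R X Xs Xt"
    unfolding X_def[abs_def] Xs_def[abs_def] Xt_def[abs_def] E_def[abs_def] n_def
    by (rule SO3_variation_axis[OF rot der cont(2) \<phi>])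
  from var[OF this]
  have d1: "((\<lambda>s. integral {a..b} (\<lambda>t. lagrangian I (X s t) (Xt s t))) has_real_derivative
      - integral {a..b} (\<lambda>t. lam t * constraint_form (R t) (Xs 0 t))) (at 0)" .
  have "lagrangian I (X s t) (Xt s t) = 1/2 * ((I *v w s t) \<bullet> w s t)" if t: "t \<in> {a..b}" for s t
  proof -
    have "vee (matrix_inv (X s t) ** Xt s t) = w s t"
      unfolding X_def Xt_def V[OF t] w_def
      by (rule body_velocity_variation) (simp_all add: rot[OF t] E_def rotation_matrix_axis_rotation)
    then show ?thesis by (simp add: lagrangian_def Let_def)
  qed
  then have action: "integral {a..b} (\<lambda>t. lagrangian I (X s t) (Xt s t))
      = integral {a..b} (\<lambda>t. 1/2 * ((I *v w s t) \<bullet> w s t))" for s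
    by (rule integral_cong)
  have w_der: "((\<lambda>s. w s t) has_vector_derivative ws s t) (at s within S)" for s t S
  proof -
    have "bounded_linear (\<lambda>M. transpose M *v \<omega> t)"
      unfolding linear_conv_bounded_linear[symmetric] linear_iff
      by (simp add: linear_simps[OF bounded_linear_transpose] matrix_vector_mult_add_rdistrib
          scaleR_matrix_vector_assoc del: transpose_matrix_vector)
    moreover have "((\<lambda>s. E s t) has_vector_derivative \<phi> t *\<^sub>R (E s t ** hat n)) (at s within S)"
      unfolding E_def n_def
      by (rule has_vector_derivative_axis_rotation_compose) (auto intro!: derivative_eq_intros)
    ultimately have "((\<lambda>s. transpose (E s t) *v \<omega> t) has_vector_derivative
        transpose (\<phi> t *\<^sub>R (E s t ** hat n)) *v \<omega> t) (at s within S)"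
      by (rule bounded_linear.has_vector_derivative)
    then show ?thesis
      unfolding w_def ws_def
      by (auto intro!: derivative_eq_intros
          simp: linear_simps[OF bounded_linear_transpose] scaleR_matrix_vector_assoc
          simp del: transpose_matrix_vector)
  qed
  have L_der: "((\<lambda>s. 1/2 * ((I *v w s t) \<bullet> w s t)) has_real_derivative (I *v w s t) \<bullet> ws s t)
      (at s within S)" for s t S
  proof -
    have "((\<lambda>s. (I *v w s t) \<bullet> w s t) has_vector_derivative
        (I *v w s t) \<bullet> ws s t + (I *v ws s t) \<bullet> w s t) (at s within S)"
      by (intro bounded_bilinear.has_vector_derivative[OF bounded_bilinear_inner] w_der
          bounded_linear.has_vector_derivative[OF matrix_vector_mul_bounded_linear])
    \<comment> \<open>Symmetry of \<open>I\<close> makes the two terms equal, which cancels the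
      factor 1/2 of the kinetic energy.\<close>
    also have "(I *v ws s t) \<bullet> w s t = (I *v w s t) \<bullet> ws s t"
      by (metis inertia_tensor_inner[OF I] inner_commute)
    finally have "((\<lambda>s. (I *v w s t) \<bullet> w s t) has_real_derivative
        (I *v w s t) \<bullet> ws s t + (I *v w s t) \<bullet> ws s t) (at s within S)"
      by (simp add: has_real_derivative_iff_has_vector_derivative)
    from DERIV_cmult[OF this, of "1/2"] show ?thesis by simp
  qed
  let ?J = "{-1<..<1::real} \<times> cbox a b"
  have snd: "continuous_on ?J (\<lambda>p. g (snd p))" if "continuous_on {a..b} g" for g :: "real \<Rightarrow> 'z::topological_space"
    by (rule continuous_on_compose2[OF that continuous_on_snd[OF continuous_on_id]]) auto
  have cE: "continuous_on ?J (\<lambda>p. E (fst p) (snd p))"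
    unfolding E_def by (intro continuous_intros snd[OF c\<phi>])
  have c_mv: "continuous_on T (\<lambda>p. M p *v v p)"
    if "continuous_on T M" "continuous_on T v"
    for T :: "(real \<times> real) set" and M :: "_ \<Rightarrow> real^3^3" and v
    using that by (simp add: matrix_vector_mult_def) (intro continuous_intros)
  have c_tr: "continuous_on T (\<lambda>p. transpose (M p))"
    if "continuous_on T M" for T :: "(real \<times> real) set" and M :: "_ \<Rightarrow> real^3^3"
    using bounded_linear.continuous_on[OF bounded_linear_transpose that] .
  have cw: "continuous_on ?J (\<lambda>p. w (fst p) (snd p))"
    unfolding w_def by (intro continuous_intros c_mv c_tr cE snd[OF cont(4)] snd[OF \<phi>(2)])
  have cws: "continuous_on ?J (\<lambda>p. ws (fst p) (snd p))"
    unfolding ws_def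
    by (intro continuous_intros c_mv c_tr cE snd[OF cont(4)] snd[OF \<phi>(2)] snd[OF c\<phi>])
  have "((\<lambda>s. integral (cbox a b) (\<lambda>t. 1/2 * ((I *v w s t) \<bullet> w s t))) has_real_derivative
      integral (cbox a b) (\<lambda>t. (I *v w 0 t) \<bullet> ws 0 t)) (at 0 within {-1<..<1})"
  proof (rule leibniz_rule_field_derivative)
    show "((\<lambda>s. 1/2 * ((I *v w s t) \<bullet> w s t)) has_real_derivative (I *v w s t) \<bullet> ws s t)
      (at s within {-1<..<1})" for s t by (rule L_der)
    show "continuous_on ?J (\<lambda>(s, t). (I *v w s t) \<bullet> ws s t)"
      unfolding case_prod_beta by (intro continuous_intros c_mv cw cws)
    fix s :: real assume s: "s \<in> {-1<..<1}"
    have "continuous_on (cbox a b) (\<lambda>t. w (fst (s, t)) (snd (s, t)))"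
      by (rule continuous_on_compose2[OF cw]) (use s in \<open>auto intro!: continuous_intros\<close>)
    then have "continuous_on (cbox a b) (\<lambda>t. w s t)" by simp
    then show "(\<lambda>t. 1/2 * ((I *v w s t) \<bullet> w s t)) integrable_on cbox a b"
      by (intro integrable_continuous continuous_intros
          bounded_linear.continuous_on[OF matrix_vector_mul_bounded_linear])
  qed auto
  then have d2: "((\<lambda>s. integral {a..b} (\<lambda>t. lagrangian I (X s t) (Xt s t))) has_real_derivative
      integral {a..b} (\<lambda>t. (I *v w 0 t) \<bullet> ws 0 t)) (at 0)"
    by (simp add: action at_within_open[of 0 "{-1<..<1}"])
  have cf: "constraint_form (R t) (Xs 0 t) = \<phi> t * e3 $ i" if t: "t \<in> {a..b}" for t
  proof -
    have "matrix_inv (R t) ** Xs 0 t = hat (\<phi> t *\<^sub>R n)"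
      by (simp add: Xs_def E_def matrix_inv_rotation rot[OF t] matrix_mult.scaleR_right matrix_mul_assoc
          rotation_matrix_transpose_mult[OF rot[OF t]] linear_simps[OF bounded_linear_hat])
    then show ?thesis by (simp add: constraint_form_def n_def inner_axis)
  qed
  have w0: "(I *v w 0 t) \<bullet> ws 0 t = \<phi>' t * (I *v \<omega> t) $ i + \<phi> t * cross3 (I *v \<omega> t) (\<omega> t) $ i" for t
  proof -
    have "(- A) *v x = - (A *v x)" for A :: "real^3^3" and x
      by (simp add: matrix_vector_mult_def vec_eq_iff sum_negf)
    then have "ws 0 t = - \<phi> t *\<^sub>R cross3 n (\<omega> t) + \<phi>' t *\<^sub>R n"
      by (simp add: ws_def E_def transpose_hat hat_works del: transpose_matrix_vector)
    \<comment> \<open>The triple product moves the axis \<open>n\<close> out of the cross product;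
      its sign cancels the one from the transposed hat, so the gyroscopic term appears as in the
      Suslov equation.\<close>
    moreover have "(I *v \<omega> t) \<bullet> cross3 n (\<omega> t) = - (cross3 (I *v \<omega> t) (\<omega> t) \<bullet> n)"
      by (simp add: cross3_simps)
    ultimately show ?thesis
      by (simp add: w_def E_def inner_diff_right n_def inner_axis)
  qed
  have "integral {a..b} (\<lambda>t. \<phi>' t * (I *v \<omega> t) $ i + \<phi> t * cross3 (I *v \<omega> t) (\<omega> t) $ i)
      = - integral {a..b} (\<lambda>t. lam t * (\<phi> t * e3 $ i))"
  proof -
    have "integral {a..b} (\<lambda>t. lam t * constraint_form (R t) (Xs 0 t))
        = integral {a..b} (\<lambda>t. lam t * (\<phi> t * e3 $ i))"
      by (rule integral_cong) (simp add: cf)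
    then show ?thesis using DERIV_unique[OF d2 d1] by (simp add: w0)
  qed
  moreover have "(\<lambda>t. \<phi>' t * (I *v \<omega> t) $ i + \<phi> t * cross3 (I *v \<omega> t) (\<omega> t) $ i) integrable_on {a..b}"
    "(\<lambda>t. lam t * (\<phi> t * e3 $ i)) integrable_on {a..b}"
    by (intro integrable_continuous_interval continuous_intros continuous_on_cross \<phi> c\<phi> cont
        bounded_linear.continuous_on[OF matrix_vector_mul_bounded_linear])+
  ultimately have "integral {a..b} (\<lambda>t. (\<phi>' t * (I *v \<omega> t) $ i + \<phi> t * cross3 (I *v \<omega> t) (\<omega> t) $ i)
      + lam t * (\<phi> t * e3 $ i)) = 0"
    by (simp add: integral_add)
  then show ?thesis by (simp add: algebra_simps)
qed

text \<open>The weak form about axis i is the hypothesis of \<open>du_bois_reymond\<close> for the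
  i-th momentum component. Thus the momentum is differentiable, and applying the inverse of
  \<open>I\<close> transfers this to the angular velocity.\<close>

lemma lagrange_dalembert_imp_suslov:
  assumes I: "inertia_tensor I" and ab: "a < b"
    and sol: "lagrange_dalembert_solution I a b R V lam"
  shows "suslov_solution I {a..b} (\<lambda>t. vee (matrix_inv (R t) ** V t)) lam"
proof -
  define \<omega> where "\<omega> t = vee (matrix_inv (R t) ** V t)" for t
  define q where "q t = cross3 (I *v \<omega> t) (\<omega> t) + lam t *\<^sub>R e3" for t
  note cont = lagrange_dalembert_continuous[OF sol, folded \<omega>_def]
  have comp: "((\<lambda>t. (I *v \<omega> t) $ i) has_real_derivative q t $ i) (at t within {a..b})"
    if t: "t \<in> {a..b}" for t i
  proof (rule du_bois_reymond[OF ab _ _ _ t])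
    show "continuous_on {a..b} (\<lambda>t. (I *v \<omega> t) $ i)" "continuous_on {a..b} (\<lambda>t. q t $ i)"
      unfolding q_def
      by (intro continuous_intros continuous_on_cross cont
          bounded_linear.continuous_on[OF matrix_vector_mul_bounded_linear])+
  next
    fix \<phi> \<phi>' :: "real \<Rightarrow> real"
    assume "\<And>t. t \<in> {a..b} \<Longrightarrow> (\<phi> has_real_derivative \<phi>' t) (at t within {a..b})"
      "continuous_on {a..b} \<phi>'" "\<phi> a = 0" "\<phi> b = 0"
    then show "integral {a..b} (\<lambda>t. \<phi>' t * (I *v \<omega> t) $ i + \<phi> t * q t $ i) = 0"
      unfolding q_def \<omega>_def by (rule lagrange_dalembert_weak_form[OF I sol])
  qed
  have vec: "(\<Sum>i\<in>UNIV. v $ i *\<^sub>R axis i 1) = v" for v :: "real^3"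
    by (simp add: vec_eq_iff forall_3 sum_3 axis_def)
  have "((\<lambda>t. I *v \<omega> t) has_vector_derivative q t) (at t within {a..b})" if t: "t \<in> {a..b}" for t
  proof -
    have "((\<lambda>t. \<Sum>i\<in>UNIV. (I *v \<omega> t) $ i *\<^sub>R (axis i 1 :: real^3)) has_vector_derivative
        (\<Sum>i\<in>UNIV. q t $ i *\<^sub>R axis i 1)) (at t within {a..b})"
    proof (rule has_vector_derivative_sum)
      show "((\<lambda>t. (I *v \<omega> t) $ i *\<^sub>R (axis i 1 :: real^3)) has_vector_derivative q t $ i *\<^sub>R axis i 1)
          (at t within {a..b})" for i
        using has_vector_derivative_scaleR[OF comp[OF t] has_vector_derivative_const] by simp
    qed
    then show ?thesis by (simp only: vec)
  qed
  note d = bounded_linear.has_vector_derivative[OF matrix_vector_mul_bounded_linear[of "matrix_inv I"] this]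
  obtain J where J: "I ** J = mat 1" "J ** I = mat 1"
    using invertible_inertia_tensor[OF I] unfolding invertible_def by blast
  then have inv: "matrix_inv I = J" by (intro matrix_inv_unique)
  have "(\<omega> has_vector_derivative J *v q t) (at t within {a..b})" if "t \<in> {a..b}" for t
    using d[OF that] by (simp add: inv matrix_vector_mul_assoc J)
  moreover have "I *v (J *v q t) = q t" for t
    by (simp add: matrix_vector_mul_assoc J)
  moreover have "\<omega> t $ 3 = 0" if "t \<in> {a..b}" for t
    using sol that constraint_distribution_velocity(2)
    unfolding lagrange_dalembert_solution_def \<omega>_def by blast
  ultimately show ?thesis
    unfolding suslov_solution_def \<omega>_def[symmetric] q_def[symmetric]
    by (intro exI[of _ "\<lambda>t. J *v q t"]) simp
qed

section \<open>The Cayley reconstruction\<close>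

lemma norm_orthogonal_matrix:
  fixes Q :: "real^'n^'n"
  assumes "orthogonal_matrix Q"
  shows "norm Q = sqrt CARD('n)"
proof -
  have "norm (Q $ i) = 1" for i
    using assms by (simp add: orthogonal_matrix_orthonormal_rows row_def)
  then show ?thesis by (simp add: norm_vec_def L2_set_constant)
qed

lemma hat_scaleR: "hat (c *\<^sub>R w) = c *\<^sub>R hat w"
  by (rule linear_simps(5)[OF bounded_linear_hat])

text \<open>A kernel vector satisfies x = s x x as a cross product, so it is orthogonal to itself.
  No smallness of \<open>s\<close> enters, so the Cayley map is a genuine quotient on all skew
  matrices.\<close>

lemma invertible_mat_1_minus_hat: "invertible (mat 1 - hat s)"
proof -
  have "x = 0" if "(mat 1 - hat s) *v x = 0" for x
  proof -
    have "x = cross3 s x"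
      using that by (simp add: matrix_vector_mult_diff_rdistrib hat_works)
    then show ?thesis using cross_eq_self(2) by metis
  qed
  then show ?thesis
    by (simp add: invertible_left_inverse matrix_left_invertible_ker)
qed

lemma cay_hat_eq:
  "cay (hat w) = mat 1 + hat ((1/2) *\<^sub>R w) ** (cay (hat w) + mat 1)"
proof -
  let ?S = "hat ((1/2) *\<^sub>R w)"
  have "(mat 1 - ?S) ** cay (hat w) = mat 1 + ?S"
    using matrix_inv_mult(2)[OF invertible_mat_1_minus_hat[of "(1/2) *\<^sub>R w"]]
    by (simp add: cay_def matrix_mul_assoc hat_scaleR)
  then show ?thesis
    by (simp add: matrix_mult.diff_left matrix_mult.add_right algebra_simps)
qed

text \<open>By \<open>cay_hat_eq\<close>, Y x - x is a cross product with Y x + x, hence orthogonal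
  to it; this says that Y x and x have equal length.\<close>

lemma orthogonal_matrix_cay_hat: "orthogonal_matrix (cay (hat w))"
proof -
  let ?Y = "cay (hat w)" and ?s = "(1/2) *\<^sub>R w"
  have "norm (?Y *v x) = norm x" for x
  proof -
    have "?Y *v x = x + cross3 ?s (?Y *v x + x)"
      using arg_cong[OF cay_hat_eq[of w], of "\<lambda>M. M *v x"]
      by (simp add: matrix_vector_mult_add_rdistrib hat_works flip: matrix_vector_mul_assoc)
    then have d: "?Y *v x - x = cross3 ?s (?Y *v x + x)"
      by (metis add_diff_cancel_left')
    have "(?Y *v x - x) \<bullet> (?Y *v x + x) = 0"
      unfolding d by (rule dot_cross_self(3))
    then have "(?Y *v x) \<bullet> (?Y *v x) = x \<bullet> x"
      by (simp add: inner_diff_left inner_diff_right inner_add_left inner_add_right inner_commute)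
    then show ?thesis by (simp add: norm_eq_sqrt_inner)
  qed
  then have "orthogonal_transformation ((*v) ?Y)"
    by (simp add: orthogonal_transformation)
  then show ?thesis by (simp add: orthogonal_transformation_matrix)
qed

text \<open>With S = (h/2) hat(w), using \<open>cay_hat_eq\<close> twice gives Y - 1 - 2 S = S (Y -
  1) = S S (Y + 1). Orthogonality bounds Y + 1 uniformly in h, so the two factors S supply
  h^2.\<close>

lemma cay_hat_bound:
  "\<exists>C. \<forall>h. norm (cay (h *\<^sub>R hat w) - mat 1 - h *\<^sub>R hat w) \<le> C * h\<^sup>2"
proof -
  obtain K where K: "K \<ge> 0" "\<And>(A :: real^3^3) (B :: real^3^3). norm (A ** B) \<le> norm A * norm B * K"
    using matrix_mult.nonneg_bounded by blast
  let ?c = "norm (hat w) / 2"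
  have "norm (cay (h *\<^sub>R hat w) - mat 1 - h *\<^sub>R hat w)
      \<le> (?c * (?c * (2 * sqrt CARD(3)) * K) * K) * h\<^sup>2" for h
  proof -
    define Y where "Y = cay (h *\<^sub>R hat w)"
    define S where "S = (h / 2) *\<^sub>R hat w"
    have Y: "Y = mat 1 + S ** (Y + mat 1)"
      using cay_hat_eq[of "h *\<^sub>R w"] by (simp add: Y_def S_def hat_scaleR)
    have "h *\<^sub>R hat w = S + S" by (simp add: S_def flip: scaleR_add_left)
    then have 1: "Y - mat 1 - h *\<^sub>R hat w = S ** (Y - mat 1)"
      using Y by (simp add: matrix_mult.add_right matrix_mult.diff_right algebra_simps)
    have 2: "Y - mat 1 = S ** (Y + mat 1)" using Y by (metis add_diff_cancel_left')
    have eq: "Y - mat 1 - h *\<^sub>R hat w = S ** (S ** (Y + mat 1))"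
      by (rule trans[OF 1]) (simp only: 2)
    have "orthogonal_matrix Y"
      using orthogonal_matrix_cay_hat[of "h *\<^sub>R w"] by (simp add: Y_def hat_scaleR)
    then have "norm (Y + mat 1) \<le> 2 * sqrt CARD(3)"
      using norm_triangle_ineq[of Y "mat 1"] norm_orthogonal_matrix[of Y]
        norm_orthogonal_matrix[OF orthogonal_matrix_id, where 'n = 3] by simp
    moreover have S: "norm S = ?c * \<bar>h\<bar>" by (simp add: S_def)
    ultimately have "norm (S ** (Y + mat 1)) \<le> (?c * \<bar>h\<bar>) * (2 * sqrt CARD(3)) * K"
      using K by (intro order_trans[OF K(2)] mult_mono) auto
    then have "norm (S ** (S ** (Y + mat 1))) \<le> (?c * \<bar>h\<bar>) * ((?c * \<bar>h\<bar>) * (2 * sqrt CARD(3)) * K) * K"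
      using K S by - (rule order_trans[OF K(2)], intro mult_mono, auto)
    also have "\<dots> = (?c * (?c * (2 * sqrt CARD(3)) * K) * K) * (\<bar>h\<bar> * \<bar>h\<bar>)"
      by (simp only: mult_ac)
    also have "\<bar>h\<bar> * \<bar>h\<bar> = h\<^sup>2" by (simp add: power2_eq_square)
    finally show ?thesis by (simp only: eq[unfolded Y_def] Y_def)
  qed
  then show ?thesis by blast
qed

text \<open>Since C C^T = 1, the matrix 1 - R C^T equals (C - R) C^T, and an orthogonal factor has
  Frobenius norm sqrt 3.\<close>

lemma SO3_dist_le:
  obtains K where "K \<ge> 0"
    "\<And>R C. orthogonal_matrix C \<Longrightarrow> SO3_dist R C \<le> K * norm (C - R)"
proof -
  obtain K where K: "K \<ge> 0" "\<And>(A :: real^3^3) (B :: real^3^3). norm (A ** B) \<le> norm A * norm B * K"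
    using matrix_mult.nonneg_bounded by blast
  show thesis
  proof
    show "SO3_dist R C \<le> (sqrt CARD(3) * K) * norm (C - R)" if C: "orthogonal_matrix C" for R C
    proof -
      have "mat 1 - R ** transpose C = (C - R) ** transpose C"
        using C by (simp add: matrix_mult.diff_left orthogonal_matrix_def)
      then have "SO3_dist R C = norm ((C - R) ** transpose C)" by (simp add: SO3_dist_def)
      also have "\<dots> \<le> norm (C - R) * norm (transpose C) * K" by (rule K)
      also have "norm (transpose C) = sqrt CARD(3)" using C by (intro norm_orthogonal_matrix) simp
      finally show ?thesis by (simp only: mult_ac)
    qed
  qed (use K in simp)
qed

lemma first_order_Taylor_bound:
  fixes f :: "real \<Rightarrow> 'a::real_normed_vector"
  assumes A: "continuous_on {t0..t0 + T} f''"
    and f: "\<And>t. t \<in> {t0..t0 + T} \<Longrightarrow> (f has_vector_derivative f' t) (at t within {t0..t0 + T})"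
    and f': "\<And>t. t \<in> {t0..t0 + T} \<Longrightarrow> (f' has_vector_derivative f'' t) (at t within {t0..t0 + T})"
  shows "\<exists>C. \<forall>s\<in>{0..T}. norm (f (t0 + s) - f t0 - s *\<^sub>R f' t0) \<le> C * s\<^sup>2"
proof -
  have "bounded (f'' ` {t0..t0 + T})"
    using A by (intro compact_imp_bounded compact_continuous_image) auto
  then obtain C where C: "\<And>t. t \<in> {t0..t0 + T} \<Longrightarrow> norm (f'' t) \<le> C"
    by (force simp: bounded_iff)
  have 1: "norm (f' (t0 + s) - f' t0) \<le> C * s" if s: "s \<in> {0..T}" for s
    using primitive_power_bound[of T "\<lambda>s. f' (t0 + s)" "\<lambda>s. f'' (t0 + s)" C 0 s]
      has_vector_derivative_shift_interval[OF f'] C s by simp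
  have "norm (f (t0 + s) - f t0 - s *\<^sub>R f' t0) \<le> C * s\<^sup>2" if s: "s \<in> {0..T}" for s
  proof -
    have "norm ((f (t0 + s) - s *\<^sub>R f' t0) - (f (t0 + 0) - 0 *\<^sub>R f' t0)) \<le> C * s ^ (1 + 1)"
    proof (rule primitive_power_bound[where T = T])
      fix u assume u: "u \<in> {0..T}"
      have "((\<lambda>s. f (t0 + s)) has_vector_derivative f' (t0 + u)) (at u within {0..T})"
        using u by (intro has_vector_derivative_shift_interval f) simp
      then show "((\<lambda>s. f (t0 + s) - s *\<^sub>R f' t0) has_vector_derivative f' (t0 + u) - f' t0)
          (at u within {0..T})"
        by (auto intro!: derivative_eq_intros)
    qed (use 1 s in auto)
    then show ?thesis by (simp add: algebra_simps power2_eq_square)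
  qed
  then show ?thesis by blast
qed

text \<open>The angular velocities hidden by the existential are recovered as body velocities, since
  old and new base points are orthogonal matrices.\<close>

lemma reconstruction_step:
  assumes "reconstruction \<Phi> h (R, V) x' l"
  shows "fst x' = R ** cay (h *\<^sub>R hat (vee (matrix_inv R ** V)))"
    and "orthogonal_matrix (fst x')"
    and "\<Phi> h (vee (matrix_inv R ** V)) (vee (matrix_inv (fst x') ** snd x')) l"
proof -
  obtain w w' where R: "rotation_matrix R" and V: "V = R ** hat w" and \<Phi>: "\<Phi> h w w' l"
    and x': "x' = (R ** cay (h *\<^sub>R hat w), R ** cay (h *\<^sub>R hat w) ** hat w')"
    using assms by (auto simp: reconstruction_def Let_def)
  have w: "vee (matrix_inv R ** V) = w"
    by (simp add: V matrix_inv_rotation[OF R] matrix_mul_assoc rotation_matrix_transpose_mult[OF R])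
  have orth: "orthogonal_matrix (fst x')"
    using R orthogonal_matrix_cay_hat[of "h *\<^sub>R w"]
    by (simp add: x' orthogonal_matrix_mul rotation_matrix_def hat_scaleR)
  have "snd x' = fst x' ** hat w'" by (simp add: x')
  then have "vee (matrix_inv (fst x') ** snd x') = w'"
    using orth by (simp add: matrix_inv_orthogonal matrix_mul_assoc orthogonal_matrix)
  then show "fst x' = R ** cay (h *\<^sub>R hat (vee (matrix_inv R ** V)))"
    "orthogonal_matrix (fst x')"
    "\<Phi> h (vee (matrix_inv R ** V)) (vee (matrix_inv (fst x') ** snd x')) l"
    using \<Phi> orth by (simp_all add: w x')
qed

text \<open>The witnesses are r = 1, limited by the Cayley update, and q = p, inherited from
  \<open>\<Phi>\<close>: passing to body velocities maps a branch of the reconstruction to a branch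
  of \<open>\<Phi>\<close> and the curve to a Suslov solution.\<close>

lemma unreduced_order_reconstruction:
  assumes I: "inertia_tensor I" and order: "suslov_velocity_order I \<Phi> p"
  shows "unreduced_order I (reconstruction \<Phi>) (min 1 p) None"
  unfolding unreduced_order_def
proof (rule exI[of _ 1], rule exI[of _ p], intro conjI refl allI impI)
  fix t0 T :: real and R V lam and X :: "real \<Rightarrow> (real^3^3) \<times> (real^3^3)" and \<Lambda>
  assume T: "0 < T" and sol: "lagrange_dalembert_solution I t0 (t0 + T) R V lam"
    and b: "step_branch (reconstruction \<Phi>) (R t0, V t0) X \<Lambda>"
  define \<omega> where "\<omega> t = vee (matrix_inv (R t) ** V t)" for t
  define W where "W h = vee (matrix_inv (fst (X h)) ** snd (X h))" for h
  have ev: "\<forall>\<^sub>F h in at_right 0. reconstruction \<Phi> h (R t0, V t0) (X h) (\<Lambda> h)"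
    and lim: "(X \<longlongrightarrow> (R t0, V t0)) (at_right 0)"
    using b by (auto simp: step_branch_def)
  obtain A where cA: "continuous_on {t0..t0 + T} A"
    and der: "\<And>t. t \<in> {t0..t0 + T} \<Longrightarrow> (R has_vector_derivative V t) (at t within {t0..t0 + T})"
      "\<And>t. t \<in> {t0..t0 + T} \<Longrightarrow> (V has_vector_derivative A t) (at t within {t0..t0 + T})"
    and rot: "\<And>t. t \<in> {t0..t0 + T} \<Longrightarrow> rotation_matrix (R t)"
    and con: "\<And>t. t \<in> {t0..t0 + T} \<Longrightarrow> V t \<in> constraint_distribution (R t)"
    using sol unfolding lagrange_dalembert_solution_def by blast
  have R0: "rotation_matrix (R t0)" and V0: "V t0 = R t0 ** hat (\<omega> t0)"
    using rot con T constraint_distribution_velocity(1)[of "R t0" "V t0"] by (simp_all add: \<omega>_def)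

  \<comment> \<open>The limit is taken with the transpose, which is linear and hence continuous; it
    agrees with the inverse along the branch and at the limit.\<close>
  have "((\<lambda>h. vee (transpose (fst (X h)) ** snd (X h))) \<longlongrightarrow>
      vee (transpose (fst (R t0, V t0)) ** snd (R t0, V t0))) (at_right 0)"
    by (intro bounded_linear.tendsto[OF bounded_linear_vee] matrix_mult.tendsto
        bounded_linear.tendsto[OF bounded_linear_transpose] tendsto_fst tendsto_snd lim)
  then have limW: "((\<lambda>h. vee (transpose (fst (X h)) ** snd (X h))) \<longlongrightarrow> \<omega> t0) (at_right 0)"
    by (simp add: \<omega>_def matrix_inv_rotation[OF R0])
  have "\<forall>\<^sub>F h in at_right 0. vee (transpose (fst (X h)) ** snd (X h)) = W h"
    using ev by eventually_elim (simp add: W_def reconstruction_step(2) matrix_inv_orthogonal)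
  from limW[unfolded tendsto_cong[OF this]] have "(W \<longlongrightarrow> \<omega> t0) (at_right 0)" .
  moreover have "\<forall>\<^sub>F h in at_right 0. \<Phi> h (\<omega> t0) (W h) (\<Lambda> h)"
    using ev by eventually_elim (simp add: W_def \<omega>_def reconstruction_step(3))
  ultimately have "step_branch \<Phi> (\<omega> t0) W \<Lambda>" by (simp add: step_branch_def)
  moreover have "suslov_solution I {t0..t0 + T} \<omega> lam"
    using lagrange_dalembert_imp_suslov[OF I _ sol] T by (simp add: \<omega>_def[abs_def])
  ultimately show "(\<lambda>h. norm (vee (matrix_inv (R (t0 + h)) ** V (t0 + h))
      - vee (matrix_inv (fst (X h)) ** snd (X h)))) \<in> O[at_right 0](\<lambda>h. h ^ (p + 1))"
    using order T unfolding suslov_velocity_order_def W_def \<omega>_def by blast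

  obtain C1 where C1: "\<And>h. norm (cay (h *\<^sub>R hat (\<omega> t0)) - mat 1 - h *\<^sub>R hat (\<omega> t0)) \<le> C1 * h\<^sup>2"
    using cay_hat_bound by blast
  obtain C2 where C2: "\<And>s. s \<in> {0..T} \<Longrightarrow> norm (R (t0 + s) - R t0 - s *\<^sub>R V t0) \<le> C2 * s\<^sup>2"
    using first_order_Taylor_bound[OF cA der] by blast
  obtain K where K: "K \<ge> 0" "\<And>(A :: real^3^3) (B :: real^3^3). norm (A ** B) \<le> norm A * norm B * K"
    using matrix_mult.nonneg_bounded by blast
  obtain D where D: "D \<ge> 0" "\<And>R C. orthogonal_matrix C \<Longrightarrow> SO3_dist R C \<le> D * norm (C - R)"
    using SO3_dist_le by blast
  have "\<forall>\<^sub>F h in at_right 0. norm (SO3_dist (R (t0 + h)) (fst (X h)))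
      \<le> (D * (norm (R t0) * C1 * K + C2)) * norm (h ^ (1 + 1))"
    using ev eventually_at_right_less[of 0] eventually_at_right_0_mult_le[OF T, of 1]
  proof eventually_elim
    case (elim h)
    let ?Y = "cay (h *\<^sub>R hat (\<omega> t0))"
    have X: "fst (X h) = R t0 ** ?Y" "orthogonal_matrix (fst (X h))"
      using reconstruction_step[OF elim(1)] by (simp_all add: \<omega>_def)
    \<comment> \<open>Both are compared with the common first-order expansion R0 (1 + h
      hat(omega0)), where R0 hat(omega0) is the initial velocity.\<close>
    have "fst (X h) - R (t0 + h)
        = R t0 ** (?Y - mat 1 - h *\<^sub>R hat (\<omega> t0)) - (R (t0 + h) - R t0 - h *\<^sub>R V t0)"
      by (simp add: X(1) V0 matrix_mult.diff_right matrix_mult.scaleR_right)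
    also have "norm \<dots> \<le> norm (R t0) * (C1 * h\<^sup>2) * K + C2 * h\<^sup>2"
      using C1[of h] order_trans[OF norm_ge_zero C1[of h]] C2[of h] K elim
      by - (rule order_trans[OF norm_triangle_ineq4 add_mono[OF order_trans[OF K(2)]]];
          auto intro!: mult_mono mult_nonneg_nonneg)
    finally have "norm (fst (X h) - R (t0 + h)) \<le> (norm (R t0) * C1 * K + C2) * h\<^sup>2"
      by (simp add: algebra_simps)
    then have "SO3_dist (R (t0 + h)) (fst (X h)) \<le> D * ((norm (R t0) * C1 * K + C2) * h\<^sup>2)"
      using D(2)[OF X(2)] D(1) by (meson mult_left_mono order_trans)
    then show ?case by (simp add: SO3_dist_def mult.assoc power2_eq_square)
  qed
  then show "(\<lambda>h. SO3_dist (R (t0 + h)) (fst (X h))) \<in> O[at_right 0](\<lambda>h. h ^ (1 + 1))"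
    by (rule bigoI)
qed simp

text \<open>The first conjunct supplies branches, over which the order statements quantify. The last
  one renders "not necessarily consistent" by an inertia tensor for which even multiplier order 0
  fails.\<close>

theorem proposition5p3:
  fixes I :: "real^3^3"
  assumes "inertia_tensor I"
  shows "(\<forall>w. w $ 3 = 0 \<longrightarrow> well_defined_step (suslov_scheme I) w) \<and>
         suslov_order I (suslov_scheme I) 2 None \<and>
         unreduced_order I (reconstruction (suslov_scheme I)) 1 None \<and>
         (\<exists>J. inertia_tensor J \<and> \<not> suslov_multiplier_order J (suslov_scheme J) 0)"
proof (intro conjI allI impI)
  show "well_defined_step (suslov_scheme I) w" if "w $ 3 = 0" for w
    by (rule well_defined_step_suslov_scheme[OF assms that])
  show "suslov_order I (suslov_scheme I) 2 None"
    by (simp add: suslov_order_def suslov_velocity_order_scheme[OF assms])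
  show "unreduced_order I (reconstruction (suslov_scheme I)) 1 None"
    using unreduced_order_reconstruction[OF assms suslov_velocity_order_scheme[OF assms]] by simp
  show "\<exists>J. inertia_tensor J \<and> \<not> suslov_multiplier_order J (suslov_scheme J) 0"
    using inertia_tensor_oblique_inertia not_suslov_multiplier_order_oblique_inertia by blast
qed

end
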